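(* Let $R=\bigoplus_{n\geq 0}R_n$ be a graded commutative (i.e. graded and commutative in the ordinary sense) $\mathbf{C}$-algebra with $R_0$ finite dimensional over $\mathbf{C}$ and $R$ finitely generated as an algebra over $R_0$, and let $\kappa\in\mathbf{C}^*$. If $M=\bigoplus_{n\geq0}M_n$ is a finitely generated graded $R$-module, then for any $N\geq 0$ and any $\lambda,\mu\in\mathbf{C}$, the module $M^\kappa_{\lambda,\mu,\geq N}$ is finitely generated as a module for the Lie algebra $R^\kappa_{\mathrm{Eul},\geq N}$.
   Context: $R^\kappa_{\mathrm{Eul}}$ denotes the graded Lie algebra with underlying graded vector space $R$ and bracket $[r,s]=\kappa(\deg(r)-\deg(s))\,rs$ for homogeneous $r,s\in R$; $R^{\kappa}_{\mathrm{Eul},\geq N}$ is its Lie subalgebra $\bigoplus_{n\geq N}R_n$. $M^\kappa_{\lambda,\mu}$ denotes the graded $R^\kappa_{\mathrm{Eul}}$-module with underlying graded vector space $M$ and action $r\cdot m=(\lambda+\mu\deg(r)-\kappa\deg(m))\,rm$ for homogeneous $r\in R$, $m\in M$. $M^\kappa_{\lambda,\mu,\geq N}=\bigoplus_{n\geq N}M_n$, a module for $R^\kappa_{\mathrm{Eul},\geq N}$. *)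

theory Defs
  imports Complex_Main "HOL-Algebra.Module" "HOL-Algebra.Generated_Rings"
    "HOL-Algebra.Algebraic_Closure_Type"
begin

section \<open>Scalars\<close>

abbreviation complex_field :: "complex ring" where
  "complex_field \<equiv> ring_of_type_algebra"

definition restrict_scalars ::
  "('a, 'r) module \<Rightarrow> ('r, 'm) module \<Rightarrow> ('a, 'm) module" where
  "restrict_scalars R M =
    \<lparr>carrier = carrier M, monoid.mult = monoid.mult M, one = \<one>\<^bsub>M\<^esub>, ring.zero = \<zero>\<^bsub>M\<^esub>, add = add M,
     module.smult = (\<lambda>a m. (a \<odot>\<^bsub>R\<^esub> \<one>\<^bsub>R\<^esub>) \<odot>\<^bsub>M\<^esub> m)\<rparr>"

text \<open>When \<open>K\<close> is a field this says that \<open>V\<close> is finite dimensional.\<close>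

definition finitely_generated_module :: "('a, 'c) ring_scheme \<Rightarrow> ('a, 'b, 'd) module_scheme \<Rightarrow> bool" where
  "finitely_generated_module K V \<longleftrightarrow> module K V \<and>
    (\<exists>S. finite S \<and> S \<subseteq> carrier V \<and>
      (\<forall>W. submodule W K V \<and> S \<subseteq> W \<longrightarrow> W = carrier V))"

section \<open>Graded algebras and modules\<close>

definition decomposition ::
  "('a, 'b) ring_scheme \<Rightarrow> (nat \<Rightarrow> 'a set) \<Rightarrow> 'a \<Rightarrow> (nat \<Rightarrow> 'a) \<Rightarrow> bool" where
  "decomposition A \<G> x c \<longleftrightarrow>
    (\<forall>n. c n \<in> \<G> n) \<and> finite {n. c n \<noteq> \<zero>\<^bsub>A\<^esub>} \<and>
    x = (\<Oplus>\<^bsub>A\<^esub>n\<in>{n. c n \<noteq> \<zero>\<^bsub>A\<^esub>}. c n)"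

text \<open>\<open>A\<close> is the internal direct sum of the additive subgroups \<open>\<G> n\<close>.\<close>

definition direct_sum :: "('a, 'b) ring_scheme \<Rightarrow> (nat \<Rightarrow> 'a set) \<Rightarrow> bool" where
  "direct_sum A \<G> \<longleftrightarrow>
    (\<forall>n. subgroup (\<G> n) (add_monoid A)) \<and>
    (\<forall>x \<in> carrier A. \<exists>!c. decomposition A \<G> x c)"

definition component ::
  "('a, 'b) ring_scheme \<Rightarrow> (nat \<Rightarrow> 'a set) \<Rightarrow> nat \<Rightarrow> 'a \<Rightarrow> 'a" where
  "component A \<G> n x = (THE c. decomposition A \<G> x c) n"

definition degrees ::
  "('a, 'b) ring_scheme \<Rightarrow> (nat \<Rightarrow> 'a set) \<Rightarrow> 'a \<Rightarrow> nat set" where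
  "degrees A \<G> x = {n. component A \<G> n x \<noteq> \<zero>\<^bsub>A\<^esub>}"

definition degree_ge ::
  "('a, 'b) ring_scheme \<Rightarrow> (nat \<Rightarrow> 'a set) \<Rightarrow> nat \<Rightarrow> 'a set" where
  "degree_ge A \<G> N = {x \<in> carrier A. \<forall>n \<in> degrees A \<G> x. N \<le> n}"

locale graded_algebra = algebra K R
  for K :: "('k, 'c) ring_scheme" and R :: "('k, 'r) module"
    and \<R> :: "nat \<Rightarrow> 'r set" +
  assumes R_direct_sum: "direct_sum R \<R>"
    and R_submodule: "submodule (\<R> n) K R"
    and R_one: "\<one>\<^bsub>R\<^esub> \<in> \<R> 0"
    and R_mult: "r \<in> \<R> i \<Longrightarrow> s \<in> \<R> j \<Longrightarrow> r \<otimes>\<^bsub>R\<^esub> s \<in> \<R> (i + j)"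

locale graded_module = graded_algebra K R \<R> + Mod: module R M
  for K :: "('k, 'c) ring_scheme" and R :: "('k, 'r) module" and \<R> :: "nat \<Rightarrow> 'r set"
    and M :: "('r, 'm) module" and \<M> :: "nat \<Rightarrow> 'm set" +
  assumes M_direct_sum: "direct_sum M \<M>"
    and M_smult: "r \<in> \<R> i \<Longrightarrow> m \<in> \<M> j \<Longrightarrow> r \<odot>\<^bsub>M\<^esub> m \<in> \<M> (i + j)"

section \<open>Lie algebras and their modules\<close>

text \<open>The underlying \<open>K\<close>-modules are \<open>module\<close> records, whose ring multiplication and unit play
  no role here; the bracket and the action are separate arguments.\<close>

locale lie_algebra = L: module K L
  for K :: "('k, 'c) ring_scheme" and L :: "('k, 'l, 'd) module_scheme"
    and br :: "'l \<Rightarrow> 'l \<Rightarrow> 'l" +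
  assumes br_closed: "\<lbrakk>x \<in> carrier L; y \<in> carrier L\<rbrakk> \<Longrightarrow> br x y \<in> carrier L"
    and br_add_left: "\<lbrakk>x \<in> carrier L; y \<in> carrier L; z \<in> carrier L\<rbrakk>
      \<Longrightarrow> br (x \<oplus>\<^bsub>L\<^esub> y) z = br x z \<oplus>\<^bsub>L\<^esub> br y z"
    and br_add_right: "\<lbrakk>x \<in> carrier L; y \<in> carrier L; z \<in> carrier L\<rbrakk>
      \<Longrightarrow> br x (y \<oplus>\<^bsub>L\<^esub> z) = br x y \<oplus>\<^bsub>L\<^esub> br x z"
    and br_smult_left: "\<lbrakk>a \<in> carrier K; x \<in> carrier L; y \<in> carrier L\<rbrakk>
      \<Longrightarrow> br (a \<odot>\<^bsub>L\<^esub> x) y = a \<odot>\<^bsub>L\<^esub> br x y"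
    and br_smult_right: "\<lbrakk>a \<in> carrier K; x \<in> carrier L; y \<in> carrier L\<rbrakk>
      \<Longrightarrow> br x (a \<odot>\<^bsub>L\<^esub> y) = a \<odot>\<^bsub>L\<^esub> br x y"
    and br_self: "x \<in> carrier L \<Longrightarrow> br x x = \<zero>\<^bsub>L\<^esub>"
    and jacobi: "\<lbrakk>x \<in> carrier L; y \<in> carrier L; z \<in> carrier L\<rbrakk>
      \<Longrightarrow> br x (br y z) \<oplus>\<^bsub>L\<^esub> br y (br z x) \<oplus>\<^bsub>L\<^esub> br z (br x y) = \<zero>\<^bsub>L\<^esub>"

locale lie_module = lie_algebra K L br + V: module K V
  for K :: "('k, 'c) ring_scheme" and L :: "('k, 'l, 'd) module_scheme"
    and br :: "'l \<Rightarrow> 'l \<Rightarrow> 'l"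
    and V :: "('k, 'v, 'e) module_scheme" and act :: "'l \<Rightarrow> 'v \<Rightarrow> 'v" +
  assumes act_closed: "\<lbrakk>x \<in> carrier L; v \<in> carrier V\<rbrakk> \<Longrightarrow> act x v \<in> carrier V"
    and act_add_left: "\<lbrakk>x \<in> carrier L; y \<in> carrier L; v \<in> carrier V\<rbrakk>
      \<Longrightarrow> act (x \<oplus>\<^bsub>L\<^esub> y) v = act x v \<oplus>\<^bsub>V\<^esub> act y v"
    and act_add_right: "\<lbrakk>x \<in> carrier L; v \<in> carrier V; w \<in> carrier V\<rbrakk>
      \<Longrightarrow> act x (v \<oplus>\<^bsub>V\<^esub> w) = act x v \<oplus>\<^bsub>V\<^esub> act x w"
    and act_smult_left: "\<lbrakk>a \<in> carrier K; x \<in> carrier L; v \<in> carrier V\<rbrakk>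
      \<Longrightarrow> act (a \<odot>\<^bsub>L\<^esub> x) v = a \<odot>\<^bsub>V\<^esub> act x v"
    and act_smult_right: "\<lbrakk>a \<in> carrier K; x \<in> carrier L; v \<in> carrier V\<rbrakk>
      \<Longrightarrow> act x (a \<odot>\<^bsub>V\<^esub> v) = a \<odot>\<^bsub>V\<^esub> act x v"
    and act_br: "\<lbrakk>x \<in> carrier L; y \<in> carrier L; v \<in> carrier V\<rbrakk>
      \<Longrightarrow> act (br x y) v = act x (act y v) \<ominus>\<^bsub>V\<^esub> act y (act x v)"

definition lie_submodule :: "'v set \<Rightarrow> ('k, 'c) ring_scheme \<Rightarrow> ('k, 'l, 'd) module_scheme
    \<Rightarrow> ('k, 'v, 'e) module_scheme \<Rightarrow> ('l \<Rightarrow> 'v \<Rightarrow> 'v) \<Rightarrow> bool" where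
  "lie_submodule W K L V act \<longleftrightarrow>
    submodule W K V \<and> (\<forall>x \<in> carrier L. \<forall>w \<in> W. act x w \<in> W)"

definition finitely_generated_lie_module :: "('k, 'c) ring_scheme
    \<Rightarrow> ('k, 'l, 'd) module_scheme \<Rightarrow> ('l \<Rightarrow> 'l \<Rightarrow> 'l)
    \<Rightarrow> ('k, 'v, 'e) module_scheme \<Rightarrow> ('l \<Rightarrow> 'v \<Rightarrow> 'v) \<Rightarrow> bool" where
  "finitely_generated_lie_module K L br V act \<longleftrightarrow> lie_module K L br V act \<and>
    (\<exists>S. finite S \<and> S \<subseteq> carrier V \<and>
      (\<forall>W. lie_submodule W K L V act \<and> S \<subseteq> W \<longrightarrow> W = carrier V))"

section \<open>The Euler Lie algebra and its modules\<close>

text \<open>The bracket \<open>[r, s] = \<kappa> (deg r - deg s) r s\<close> and the action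
  \<open>r m = (\<lambda> + \<mu> deg r - \<kappa> deg m) r m\<close> of homogeneous elements, extended biadditively.\<close>

definition euler_bracket :: "complex \<Rightarrow> (complex, 'r) module \<Rightarrow> (nat \<Rightarrow> 'r set)
    \<Rightarrow> 'r \<Rightarrow> 'r \<Rightarrow> 'r" where
  "euler_bracket \<kappa> R \<R> r s =
    (\<Oplus>\<^bsub>R\<^esub>i\<in>degrees R \<R> r. \<Oplus>\<^bsub>R\<^esub>j\<in>degrees R \<R> s.
      (\<kappa> * (of_nat i - of_nat j)) \<odot>\<^bsub>R\<^esub> (component R \<R> i r \<otimes>\<^bsub>R\<^esub> component R \<R> j s))"

definition euler_action :: "complex \<Rightarrow> complex \<Rightarrow> complex
    \<Rightarrow> (complex, 'r) module \<Rightarrow> (nat \<Rightarrow> 'r set) \<Rightarrow> ('r, 'm) module \<Rightarrow> (nat \<Rightarrow> 'm set)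
    \<Rightarrow> 'r \<Rightarrow> 'm \<Rightarrow> 'm" where
  "euler_action \<kappa> l \<mu> R \<R> M \<M> r m =
    (\<Oplus>\<^bsub>M\<^esub>i\<in>degrees R \<R> r. \<Oplus>\<^bsub>M\<^esub>j\<in>degrees M \<M> m.
      (l + \<mu> * of_nat i - \<kappa> * of_nat j) \<odot>\<^bsub>restrict_scalars R M\<^esub>
        (component R \<R> i r \<odot>\<^bsub>M\<^esub> component M \<M> j m))"

lemma component_homogeneous:
  assumes A: "abelian_group A" and D: "direct_sum A \<G>" and x: "x \<in> \<G> i"
  shows "component A \<G> k x = (if k = i then x else \<zero>\<^bsub>A\<^esub>)"
proof -
  interpret A: abelian_group A by (rule A)
  have sub: "subgroup (\<G> n) (add_monoid A)" for n
    using D by (simp add: direct_sum_def)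
  have xA: "x \<in> carrier A"
    using subgroup.subset[OF sub] x by auto
  let ?c = "\<lambda>k. if k = i then x else \<zero>\<^bsub>A\<^esub>"
  have "decomposition A \<G> x ?c"
  proof (cases "x = \<zero>\<^bsub>A\<^esub>")
    case True
    then show ?thesis
      using subgroup.one_closed[OF sub] by (simp add: decomposition_def)
  next
    case False
    then have eq: "{n. ?c n \<noteq> \<zero>\<^bsub>A\<^esub>} = {i}" by auto
    have "(\<Oplus>\<^bsub>A\<^esub>n\<in>{i}. ?c n) = x"
      using xA by (subst A.finsum_insert) auto
    then show ?thesis
      unfolding decomposition_def eq using x subgroup.one_closed[OF sub] by simp
  qed
  moreover have "\<exists>!c. decomposition A \<G> x c"
    using D xA by (simp add: direct_sum_def)
  ultimately have "(THE c. decomposition A \<G> x c) = ?c"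
    by (rule the1_equality[rotated])
  then show ?thesis by (simp add: component_def)
qed

lemma degrees_homogeneous:
  assumes "abelian_group A" "direct_sum A \<G>" "x \<in> \<G> i"
  shows "degrees A \<G> x = (if x = \<zero>\<^bsub>A\<^esub> then {} else {i})"
  by (auto simp: degrees_def component_homogeneous[OF assms])

lemma euler_bracket_homogeneous:
  assumes G: "graded_algebra complex_field R \<R>" and r: "r \<in> \<R> i" and s: "s \<in> \<R> j"
  shows "euler_bracket \<kappa> R \<R> r s = (\<kappa> * (of_nat i - of_nat j)) \<odot>\<^bsub>R\<^esub> (r \<otimes>\<^bsub>R\<^esub> s)"
proof -
  interpret graded_algebra complex_field R \<R> by (rule G)
  note ag = M.abelian_group_axioms
  have c: "r \<in> carrier R" "s \<in> carrier R"
    using r s subgroup.subset[of _ "add_monoid R"] R_direct_sum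
    by (fastforce simp: direct_sum_def)+
  have sm: "a \<odot>\<^bsub>R\<^esub> x \<in> carrier R" if "x \<in> carrier R" for a x
    using that by (simp add: ring_of_type_algebra_def)
  have z: "a \<odot>\<^bsub>R\<^esub> \<zero>\<^bsub>R\<^esub> = \<zero>\<^bsub>R\<^esub>" for a
    using smult_r_null by (simp add: ring_of_type_algebra_def)
  show ?thesis
    unfolding euler_bracket_def degrees_homogeneous[OF ag R_direct_sum r]
      degrees_homogeneous[OF ag R_direct_sum s] component_homogeneous[OF ag R_direct_sum r]
      component_homogeneous[OF ag R_direct_sum s]
    using c by (auto simp: M.finsum_insert sm z)
qed

lemma euler_action_homogeneous:
  assumes G: "graded_module complex_field R \<R> M \<M>" and r: "r \<in> \<R> i" and m: "m \<in> \<M> j"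
  shows "euler_action \<kappa> l \<mu> R \<R> M \<M> r m =
    (l + \<mu> * of_nat i - \<kappa> * of_nat j) \<odot>\<^bsub>restrict_scalars R M\<^esub> (r \<odot>\<^bsub>M\<^esub> m)"
proof -
  interpret G: graded_module complex_field R \<R> M \<M> by (rule G)
  note agR = G.M.abelian_group_axioms and agM = G.Mod.M.abelian_group_axioms
  note dR = G.R_direct_sum and dM = G.M_direct_sum
  have c: "r \<in> carrier R" "m \<in> carrier M"
    using r m subgroup.subset[of _ "add_monoid R"] subgroup.subset[of _ "add_monoid M"] dR dM
    by (fastforce simp: direct_sum_def)+
  have e: "a \<odot>\<^bsub>R\<^esub> \<one>\<^bsub>R\<^esub> \<in> carrier R" for a
    by (rule G.smult_closed) (simp_all add: ring_of_type_algebra_def)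
  have rs: "a \<odot>\<^bsub>restrict_scalars R M\<^esub> x = (a \<odot>\<^bsub>R\<^esub> \<one>\<^bsub>R\<^esub>) \<odot>\<^bsub>M\<^esub> x" for a x
    by (simp add: restrict_scalars_def)
  show ?thesis
    unfolding euler_action_def degrees_homogeneous[OF agR dR r] degrees_homogeneous[OF agM dM m]
      component_homogeneous[OF agR dR r] component_homogeneous[OF agM dM m]
    using c e by (auto simp: rs G.Mod.M.finsum_insert)
qed

end

theory Submission
  imports Defs
begin

text \<open>The action of \<open>r\<close> on \<open>m\<close> is ordinary multiplication up to the scalar
  \<open>\<lambda> + \<mu> deg r - \<kappa> deg m\<close>. Since \<open>\<kappa> \<noteq> 0\<close>, for each degree of \<open>r\<close> this scalar vanishes for at most
  one degree of \<open>m\<close>. So if only finitely many degrees of \<open>r\<close> are ever used, then above some degree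
  of the product the scalar can be divided out, and a Lie submodule that contains \<open>m\<close> contains \<open>r m\<close>.

  Finitely many degrees of \<open>r\<close> suffice. Let \<open>d\<close> bound the degrees of homogeneous algebra generators
  of positive degree, and let \<open>p > N\<close>. Multiplying the factors of a monomial of degree at least
  \<open>p\<close> one after the other, one passes through a degree \<open>i\<close> with \<open>p \<le> i \<le> p + d\<close>. Hence
  \<open>R\<^sub>n = \<Sum>\<^sub>i R\<^sub>i R\<^bsub>n-i\<^esub>\<close> over these \<open>i\<close> (\<open>split_off_factor\<close>), and in large degrees
  \<open>M\<^sub>n = \<Sum>\<^sub>i R\<^sub>i M\<^bsub>n-i\<^esub>\<close> because \<open>M\<close> is generated in bounded degrees. By induction
  on the degree, a Lie submodule that contains \<open>M\<^sub>n\<close> for \<open>N \<le> n \<le> n\<^sub>0\<close>, with \<open>n\<^sub>0\<close> large, is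
  everything.

  These finitely many \<open>M\<^sub>n\<close> are finite dimensional (\<open>finite_dim_degree_algebra\<close>,
  \<open>finite_dim_step\<close>), because \<open>R\<^sub>0\<close> is and everything is finitely generated. Bases of them form a
  finite generating set.

  That the truncations are a Lie algebra and a Lie module is part of the claim
  (\<open>lie_module_degree_ge\<close>). The identities, with antisymmetry in place of \<open>[r, r] = 0\<close>, are
  additive in each argument, so they need only be checked on homogeneous elements, where they are
  identities between scalars. The bracket is the action of \<open>R\<close>
  on itself with \<open>\<lambda> = 0\<close> and \<open>\<mu> = \<kappa>\<close>, so its properties are those of the action.\<close>

section \<open>Homogeneous components\<close>

lemma (in abelian_group) additive_subgroup_if_closed:
  assumes "W \<subseteq> carrier G" "\<zero> \<in> W" "\<And>x y. x \<in> W \<Longrightarrow> y \<in> W \<Longrightarrow> x \<oplus> y \<in> W"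
    "\<And>x. x \<in> W \<Longrightarrow> \<ominus> x \<in> W"
  shows "additive_subgroup W G"
  using assms by (intro additive_subgroup.intro subgroup.intro) (auto simp: a_inv_def)

lemma (in abelian_group) additive_subgroup_minus:
  "additive_subgroup W G \<Longrightarrow> x \<in> W \<Longrightarrow> \<ominus> x \<in> W"
  using subgroup.m_inv_closed[of W "add_monoid G" x] by (simp add: additive_subgroup_def a_inv_def)

lemma (in abelian_group) finsum_in_additive_subgroup:
  assumes W: "additive_subgroup W G" and f: "\<And>i. i \<in> F \<Longrightarrow> f i \<in> W"
  shows "(\<Oplus>i\<in>F. f i) \<in> W"
proof (cases "finite F")
  case True
  interpret W: additive_subgroup W G by (rule W)
  from True f show ?thesis
    by (induction F) (auto simp: finsum_insert Pi_def W.a_Hcarr)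
next
  case False
  then show ?thesis
    using additive_subgroup.zero_closed[OF W] by (simp add: finsum_infinite)
qed

lemma (in abelian_group) finsum_mono_neutral:
  assumes "finite F" "E \<subseteq> F" "f \<in> F \<rightarrow> carrier G" "\<And>i. i \<in> F - E \<Longrightarrow> f i = \<zero>"
  shows "(\<Oplus>i\<in>E. f i) = (\<Oplus>i\<in>F. f i)"
  using assms by (intro add.finprod_mono_neutral_cong_left) auto

locale graded_group = abelian_group A
  for A :: "('a, 'b) ring_scheme" (structure) and \<G> :: "nat \<Rightarrow> 'a set" +
  assumes direct_sum: "direct_sum A \<G>"
begin

abbreviation part :: "nat \<Rightarrow> 'a \<Rightarrow> 'a" where
  "part \<equiv> component A \<G>"

lemma homogeneous_subgroup: "additive_subgroup (\<G> n) A"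
  using direct_sum by (simp add: direct_sum_def additive_subgroupI)

lemma homogeneous_closed: "x \<in> \<G> n \<Longrightarrow> x \<in> carrier A"
  using additive_subgroup.a_Hcarr[OF homogeneous_subgroup] .

lemma zero_homogeneous: "\<zero> \<in> \<G> n"
  using additive_subgroup.zero_closed[OF homogeneous_subgroup] .

lemma decomposition_part:
  assumes "x \<in> carrier A"
  shows "decomposition A \<G> x (\<lambda>n. part n x)"
proof -
  have "\<exists>!c. decomposition A \<G> x c"
    using direct_sum assms by (simp add: direct_sum_def)
  then show ?thesis
    unfolding component_def by (rule theI')
qed

lemma part_in [simp]: "x \<in> carrier A \<Longrightarrow> part n x \<in> \<G> n"
  using decomposition_part by (simp add: decomposition_def)

lemma part_closed [simp]: "x \<in> carrier A \<Longrightarrow> part n x \<in> carrier A"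
  by (rule homogeneous_closed[OF part_in])

lemma finite_degrees: "x \<in> carrier A \<Longrightarrow> finite (degrees A \<G> x)"
  using decomposition_part by (simp add: decomposition_def degrees_def)

lemma sum_part:
  assumes "x \<in> carrier A" "finite F" "degrees A \<G> x \<subseteq> F"
  shows "(\<Oplus>n\<in>F. part n x) = x"
proof -
  have "x = (\<Oplus>n\<in>degrees A \<G> x. part n x)"
    using decomposition_part[OF assms(1)] by (simp add: decomposition_def degrees_def)
  also have "\<dots> = (\<Oplus>n\<in>F. part n x)"
    using assms by (intro finsum_mono_neutral) (auto simp: degrees_def)
  finally show ?thesis ..
qed

lemma part_homogeneous:
  "x \<in> \<G> i \<Longrightarrow> part k x = (if k = i then x else \<zero>)"
  by (rule component_homogeneous[OF abelian_group_axioms direct_sum])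

lemma part_add:
  assumes x: "x \<in> carrier A" and y: "y \<in> carrier A"
  shows "part n (x \<oplus> y) = part n x \<oplus> part n y"
proof -
  let ?c = "\<lambda>n. part n x \<oplus> part n y" and ?F = "degrees A \<G> x \<union> degrees A \<G> y"
  have fin: "finite ?F" using finite_degrees x y by simp
  have sub: "{n. ?c n \<noteq> \<zero>} \<subseteq> ?F" by (auto simp: degrees_def)
  have "x \<oplus> y = (\<Oplus>n\<in>?F. part n x) \<oplus> (\<Oplus>n\<in>?F. part n y)"
    using sum_part[OF x fin] sum_part[OF y fin] by simp
  also have "\<dots> = (\<Oplus>n\<in>?F. ?c n)"
    using x y by (subst finsum_addf) auto
  also have "\<dots> = (\<Oplus>n\<in>{n. ?c n \<noteq> \<zero>}. ?c n)"
    using x y fin sub by (intro finsum_mono_neutral[symmetric]) auto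
  finally have "decomposition A \<G> (x \<oplus> y) ?c"
    unfolding decomposition_def
    using x y finite_subset[OF sub fin] additive_subgroup.a_closed[OF homogeneous_subgroup]
    by auto
  moreover have "\<exists>!c. decomposition A \<G> (x \<oplus> y) c"
    using direct_sum x y by (simp add: direct_sum_def)
  ultimately show ?thesis
    using decomposition_part[of "x \<oplus> y"] x y by (metis add.m_closed)
qed

lemma part_zero [simp]: "part n \<zero> = \<zero>"
  using part_homogeneous[OF zero_homogeneous[of n], of n] by simp

lemma part_minus:
  assumes "x \<in> carrier A"
  shows "part n (\<ominus> x) = \<ominus> part n x"
proof (rule minus_equality[symmetric])
  show "part n (\<ominus> x) \<oplus> part n x = \<zero>"
    using part_add[of "\<ominus> x" x n] assms by (simp add: l_neg)
qed (use assms in auto)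

lemma degree_ge_iff:
  "x \<in> degree_ge A \<G> N \<longleftrightarrow> x \<in> carrier A \<and> (\<forall>n<N. part n x = \<zero>)"
  unfolding degree_ge_def degrees_def using linorder_not_le by blast

lemma degree_ge_0: "degree_ge A \<G> 0 = carrier A"
  by (auto simp: degree_ge_def)

lemma degree_ge_antimono: "M \<le> N \<Longrightarrow> degree_ge A \<G> N \<subseteq> degree_ge A \<G> M"
  by (auto simp: degree_ge_def)

lemma degree_ge_subgroup: "additive_subgroup (degree_ge A \<G> N) A"
  by (rule additive_subgroup_if_closed) (auto simp: degree_ge_iff part_add part_minus)

lemma homogeneous_degree_ge: "x \<in> \<G> n \<Longrightarrow> N \<le> n \<Longrightarrow> x \<in> degree_ge A \<G> N"
  by (auto simp: degree_ge_iff part_homogeneous homogeneous_closed)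

text \<open>Additive statements need only be checked on homogeneous elements, because an element is the sum of
  its components. The truncation \<open>N\<close> is kept so that the same rule serves for \<open>degree_ge\<close>; the
  whole group is the case \<open>N = 0\<close>.\<close>

lemma degree_ge_induct [consumes 1, case_names homogeneous add]:
  assumes x: "x \<in> degree_ge A \<G> N"
    and hom: "\<And>n x. N \<le> n \<Longrightarrow> x \<in> \<G> n \<Longrightarrow> P x"
    and add: "\<And>x y. x \<in> carrier A \<Longrightarrow> y \<in> carrier A \<Longrightarrow> P x \<Longrightarrow> P y \<Longrightarrow> P (x \<oplus> y)"
  shows "P x"
proof -
  have xA: "x \<in> carrier A" using x by (simp add: degree_ge_def)
  have "P (\<Oplus>n\<in>F. part n x)" if "finite F" "F \<subseteq> degrees A \<G> x" for F
    using that
  proof (induction F)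
    case empty
    then show ?case using hom[OF order_refl zero_homogeneous] by simp
  next
    case (insert n F)
    then have "N \<le> n" using x by (auto simp: degree_ge_def)
    then have "P (part n x)" using hom xA by simp
    then show ?case using insert xA by (auto simp: finsum_insert intro!: add)
  qed
  from this[OF finite_degrees[OF xA] order_refl] show ?thesis
    using sum_part[OF xA finite_degrees[OF xA] order_refl] by simp
qed

lemmas homogeneous_induct [consumes 1, case_names homogeneous add] =
  degree_ge_induct[where N = 0, unfolded degree_ge_0]

end

section \<open>Complex scalars on a graded module\<close>

lemma complex_field_simps [simp]:
  "carrier complex_field = UNIV" "a \<otimes>\<^bsub>complex_field\<^esub> b = a * b" "a \<oplus>\<^bsub>complex_field\<^esub> b = a + b"
  "\<one>\<^bsub>complex_field\<^esub> = 1" "\<zero>\<^bsub>complex_field\<^esub> = 0"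
  by (simp_all add: ring_of_type_algebra_def)

lemma restrict_scalars_simps [simp]:
  "carrier (restrict_scalars R M) = carrier M" "\<zero>\<^bsub>restrict_scalars R M\<^esub> = \<zero>\<^bsub>M\<^esub>"
  "add (restrict_scalars R M) = add M" "a_inv (restrict_scalars R M) = a_inv M"
  "a_minus (restrict_scalars R M) = a_minus M"
  by (simp_all add: restrict_scalars_def a_inv_def a_minus_def m_inv_def fun_eq_iff)

text \<open>The record types of \<open>M\<close> and \<open>restrict_scalars R M\<close> differ, so facts about their additive groups
  have to be carried over explicitly.\<close>

lemma subgroup_restrict_scalars:
  "subgroup W (add_monoid (restrict_scalars R M)) \<longleftrightarrow> additive_subgroup W M"
  by (simp add: additive_subgroup_def subgroup_def m_inv_def)

lemma abelian_group_restrict_scalars: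
  assumes "abelian_group M"
  shows "abelian_group (restrict_scalars R M)"
proof -
  interpret abelian_group M by (rule assms)
  show ?thesis
    by (rule abelian_groupI) (auto simp: a_ac intro: l_neg)
qed

lemma submodule_of_submodule:
  assumes "submodule W K (V\<lparr>carrier := H\<rparr>)" "submodule H K V" "module K V"
  shows "submodule W K V"
proof -
  interpret module K V by (rule assms)
  have "subgroup W ((add_monoid V)\<lparr>carrier := H\<rparr>)"
    using submodule.axioms(1)[OF assms(1)] by simp
  then have "subgroup W (add_monoid V)"
    using group.incl_subgroup[OF M.a_group submodule.axioms(1)[OF assms(2)]] by simp
  then show ?thesis
    using submodule.smult_closed[OF assms(1)]
    by (intro submodule.intro submodule_axioms.intro) auto
qed

locale complex_graded_module = graded_module complex_field R \<R> M \<M>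
  for R :: "(complex, 'r) module" and \<R> and M :: "('r, 'm) module" and \<M>
begin

sublocale RG: graded_group R \<R>
  by unfold_locales (rule R_direct_sum)

sublocale MG: graded_group M \<M>
  by unfold_locales (rule M_direct_sum)

abbreviation scale :: "complex \<Rightarrow> 'm \<Rightarrow> 'm" where
  "scale \<equiv> module.smult (restrict_scalars R M)"

abbreviation emb :: "complex \<Rightarrow> 'r" where
  "emb a \<equiv> a \<odot>\<^bsub>R\<^esub> \<one>\<^bsub>R\<^esub>"

lemma scale_def: "scale a m = emb a \<odot>\<^bsub>M\<^esub> m"
  by (simp add: restrict_scalars_def)

text \<open>Complex scalars act through \<open>R\<^sub>0\<close>, hence preserve degrees; everything proved about homogeneous ring
  elements of degree 0 applies to them.\<close>

lemma emb_homogeneous: "emb a \<in> \<R> 0"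
  using submodule.smult_closed[OF R_submodule _ R_one] by simp

lemma emb_closed [simp]: "emb a \<in> carrier R"
  by (rule RG.homogeneous_closed[OF emb_homogeneous])

lemma emb_mult: "emb a \<otimes>\<^bsub>R\<^esub> r = a \<odot>\<^bsub>R\<^esub> r" if "r \<in> carrier R"
  using that smult_assoc2[of a "\<one>\<^bsub>R\<^esub>" r] by simp

sublocale C: module complex_field "restrict_scalars R M"
proof (rule moduleI)
  show "cring complex_field" by (rule R.cring_axioms)
  show "abelian_group (restrict_scalars R M)"
    by (rule abelian_group_restrict_scalars[OF Mod.M.abelian_group_axioms])
  fix a b x assume x: "x \<in> carrier (restrict_scalars R M)"
  show "(a \<oplus>\<^bsub>complex_field\<^esub> b) \<odot>\<^bsub>restrict_scalars R M\<^esub> x =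
      a \<odot>\<^bsub>restrict_scalars R M\<^esub> x \<oplus>\<^bsub>restrict_scalars R M\<^esub> b \<odot>\<^bsub>restrict_scalars R M\<^esub> x"
    using x smult_l_distr[of a b "\<one>\<^bsub>R\<^esub>"] by (simp add: scale_def Mod.smult_l_distr)
  have "emb (a * b) = emb a \<otimes>\<^bsub>R\<^esub> emb b"
    using smult_assoc1[of a b "\<one>\<^bsub>R\<^esub>"] by (simp add: emb_mult)
  then show "(a \<otimes>\<^bsub>complex_field\<^esub> b) \<odot>\<^bsub>restrict_scalars R M\<^esub> x =
      a \<odot>\<^bsub>restrict_scalars R M\<^esub> (b \<odot>\<^bsub>restrict_scalars R M\<^esub> x)"
    using x by (simp add: scale_def Mod.smult_assoc1)
  show "\<one>\<^bsub>complex_field\<^esub> \<odot>\<^bsub>restrict_scalars R M\<^esub> x = x"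
    using x smult_one[of "\<one>\<^bsub>R\<^esub>"] by (simp add: scale_def)
qed (auto simp: scale_def Mod.smult_r_distr)

lemma scale_closed [simp]: "m \<in> carrier M \<Longrightarrow> scale a m \<in> carrier M"
  using C.smult_closed by simp

lemma scale_homogeneous: "m \<in> \<M> j \<Longrightarrow> scale a m \<in> \<M> j"
  using M_smult[OF emb_homogeneous] by (simp add: scale_def)

lemma scale_add: "x \<in> carrier M \<Longrightarrow> y \<in> carrier M \<Longrightarrow>
    scale a (x \<oplus>\<^bsub>M\<^esub> y) = scale a x \<oplus>\<^bsub>M\<^esub> scale a y"
  using C.smult_r_distr[of a x y] by simp

lemma scale_plus: "x \<in> carrier M \<Longrightarrow> scale (a + b) x = scale a x \<oplus>\<^bsub>M\<^esub> scale b x"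
  using C.smult_l_distr[of a b x] by simp

lemma scale_scale: "x \<in> carrier M \<Longrightarrow> scale a (scale b x) = scale (a * b) x"
  using C.smult_assoc1[of a b x] by simp

lemma scale_1: "x \<in> carrier M \<Longrightarrow> scale 1 x = x"
  using C.smult_one[of x] by simp

lemma scale_zero [simp]: "scale a \<zero>\<^bsub>M\<^esub> = \<zero>\<^bsub>M\<^esub>"
  using C.smult_r_null[of a] by simp

lemma smult_scale: "r \<in> carrier R \<Longrightarrow> x \<in> carrier M \<Longrightarrow> r \<odot>\<^bsub>M\<^esub> scale a x = scale a (r \<odot>\<^bsub>M\<^esub> x)"
  by (simp add: scale_def Mod.smult_assoc1[symmetric] m_comm)

lemma scale_smult: "r \<in> carrier R \<Longrightarrow> x \<in> carrier M \<Longrightarrow> (a \<odot>\<^bsub>R\<^esub> r) \<odot>\<^bsub>M\<^esub> x = scale a (r \<odot>\<^bsub>M\<^esub> x)"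
  by (simp add: scale_def Mod.smult_assoc1[symmetric] emb_mult)

lemma part_smult:
  assumes r: "r \<in> \<R> i" and m: "m \<in> carrier M"
  shows "MG.part n (r \<odot>\<^bsub>M\<^esub> m) = (if i \<le> n then r \<odot>\<^bsub>M\<^esub> MG.part (n - i) m else \<zero>\<^bsub>M\<^esub>)"
  using m
proof (induction m rule: MG.homogeneous_induct)
  case (homogeneous j m)
  then show ?case
    using RG.homogeneous_closed[OF r]
    by (auto simp: MG.part_homogeneous[OF M_smult[OF r homogeneous(2)]] MG.part_homogeneous[OF homogeneous(2)])
next
  case (add x y)
  then show ?case
    using RG.homogeneous_closed[OF r] by (auto simp: Mod.smult_r_distr MG.part_add)
qed

lemma degree_ge_submodule:
  "submodule (degree_ge M \<M> N) complex_field (restrict_scalars R M)"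
proof (intro submodule.intro submodule_axioms.intro)
  show "subgroup (degree_ge M \<M> N) (add_monoid (restrict_scalars R M))"
    unfolding subgroup_restrict_scalars by (rule MG.degree_ge_subgroup)
  show "scale a x \<in> degree_ge M \<M> N" if "x \<in> degree_ge M \<M> N" for a x
    using that unfolding scale_def MG.degree_ge_iff by (auto simp: part_smult[OF emb_homogeneous])
qed

end

section \<open>The Euler action and bracket\<close>

locale euler_module = complex_graded_module R \<R> M \<M>
  for R :: "(complex, 'r) module" and \<R> and M :: "('r, 'm) module" and \<M> +
  fixes \<kappa> l \<mu> :: complex
begin

abbreviation act :: "'r \<Rightarrow> 'm \<Rightarrow> 'm" where
  "act \<equiv> euler_action \<kappa> l \<mu> R \<R> M \<M>"

abbreviation coef :: "nat \<Rightarrow> nat \<Rightarrow> complex" where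
  "coef i j \<equiv> l + \<mu> * of_nat i - \<kappa> * of_nat j"

lemma act_homogeneous: "r \<in> \<R> i \<Longrightarrow> m \<in> \<M> j \<Longrightarrow> act r m = scale (coef i j) (r \<odot>\<^bsub>M\<^esub> m)"
  by (rule euler_action_homogeneous[OF graded_module_axioms])

text \<open>The definition sums over the degrees that occur in the arguments, and these change under addition.
  Any larger finite index sets give the same value, so the two sides of an additivity statement can be
  compared over common index sets.\<close>

lemma act_eq:
  assumes r: "r \<in> carrier R" and m: "m \<in> carrier M"
    and I: "finite I" "degrees R \<R> r \<subseteq> I" and J: "finite J" "degrees M \<M> m \<subseteq> J"
  shows "act r m = (\<Oplus>\<^bsub>M\<^esub>i\<in>I. \<Oplus>\<^bsub>M\<^esub>j\<in>J. scale (coef i j) (RG.part i r \<odot>\<^bsub>M\<^esub> MG.part j m))"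
proof -
  have inner: "(\<Oplus>\<^bsub>M\<^esub>j\<in>degrees M \<M> m. scale (coef i j) (RG.part i r \<odot>\<^bsub>M\<^esub> MG.part j m)) =
      (\<Oplus>\<^bsub>M\<^esub>j\<in>J. scale (coef i j) (RG.part i r \<odot>\<^bsub>M\<^esub> MG.part j m))" for i
    using r m J by (intro Mod.M.finsum_mono_neutral) (auto simp: degrees_def)
  show ?thesis
    unfolding euler_action_def inner
    using r m I by (intro Mod.M.finsum_mono_neutral)
      (auto simp: degrees_def intro!: Mod.M.add.finprod_one_eqI)
qed

lemma act_closed [simp]: "r \<in> carrier R \<Longrightarrow> m \<in> carrier M \<Longrightarrow> act r m \<in> carrier M"
  unfolding euler_action_def by (intro Mod.M.finsum_closed) auto

lemma act_add_left:
  assumes "x \<in> carrier R" "y \<in> carrier R" "m \<in> carrier M"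
  shows "act (x \<oplus>\<^bsub>R\<^esub> y) m = act x m \<oplus>\<^bsub>M\<^esub> act y m"
proof -
  let ?I = "degrees R \<R> x \<union> degrees R \<R> y" and ?J = "degrees M \<M> m"
  have fin: "finite ?I" "finite ?J" using assms RG.finite_degrees MG.finite_degrees by auto
  have sub: "degrees R \<R> (x \<oplus>\<^bsub>R\<^esub> y) \<subseteq> ?I"
    using assms by (auto simp: degrees_def RG.part_add)
  have eq: "act z m = (\<Oplus>\<^bsub>M\<^esub>i\<in>?I. \<Oplus>\<^bsub>M\<^esub>j\<in>?J. scale (coef i j) (RG.part i z \<odot>\<^bsub>M\<^esub> MG.part j m))"
    if "z \<in> carrier R" "degrees R \<R> z \<subseteq> ?I" for z
    using that assms fin by (intro act_eq) auto
  show ?thesis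
    using assms sub
    by (simp add: eq RG.part_add Mod.smult_l_distr scale_add Mod.M.finsum_addf Pi_def)
qed

lemma act_add_right:
  assumes "x \<in> carrier R" "m \<in> carrier M" "n \<in> carrier M"
  shows "act x (m \<oplus>\<^bsub>M\<^esub> n) = act x m \<oplus>\<^bsub>M\<^esub> act x n"
proof -
  let ?I = "degrees R \<R> x" and ?J = "degrees M \<M> m \<union> degrees M \<M> n"
  have fin: "finite ?I" "finite ?J" using assms RG.finite_degrees MG.finite_degrees by auto
  have sub: "degrees M \<M> (m \<oplus>\<^bsub>M\<^esub> n) \<subseteq> ?J"
    using assms by (auto simp: degrees_def MG.part_add)
  have eq: "act x z = (\<Oplus>\<^bsub>M\<^esub>i\<in>?I. \<Oplus>\<^bsub>M\<^esub>j\<in>?J. scale (coef i j) (RG.part i x \<odot>\<^bsub>M\<^esub> MG.part j z))"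
    if "z \<in> carrier M" "degrees M \<M> z \<subseteq> ?J" for z
    using that assms fin by (intro act_eq) auto
  show ?thesis
    using assms sub
    by (simp add: eq MG.part_add Mod.smult_r_distr scale_add Mod.M.finsum_addf Pi_def)
qed

lemma act_in_degree_ge:
  assumes "x \<in> degree_ge R \<R> i" "m \<in> degree_ge M \<M> j"
  shows "act x m \<in> degree_ge M \<M> (i + j)"
proof -
  note cl = additive_subgroup.a_closed[OF MG.degree_ge_subgroup]
  have mM: "m \<in> carrier M" using assms(2) by (simp add: degree_ge_def)
  show ?thesis
    using assms
  proof (induction x rule: RG.degree_ge_induct)
    case (homogeneous i' r)
    then have rR: "r \<in> carrier R" by (simp add: RG.homogeneous_closed)
    show ?case
      using assms(2)
    proof (induction m rule: MG.degree_ge_induct)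
      case (homogeneous j' v)
      then show ?case
        using \<open>i \<le> i'\<close> \<open>r \<in> \<R> i'\<close>
        by (auto simp: act_homogeneous intro!: MG.homogeneous_degree_ge scale_homogeneous M_smult)
    qed (use rR in \<open>simp add: act_add_right cl\<close>)
  qed (use mM in \<open>simp add: act_add_left cl\<close>)
qed

lemma act_smult_left:
  assumes "x \<in> carrier R" "m \<in> carrier M"
  shows "act (a \<odot>\<^bsub>R\<^esub> x) m = scale a (act x m)"
  using assms
proof (induction x rule: RG.homogeneous_induct)
  case (homogeneous i r)
  then have r: "r \<in> carrier R" "a \<odot>\<^bsub>R\<^esub> r \<in> \<R> i"
    using submodule.smult_closed[OF R_submodule] by (auto simp: RG.homogeneous_closed)
  show ?case
    using homogeneous(3)
  proof (induction m rule: MG.homogeneous_induct)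
    case (homogeneous j v)
    then show ?case
      using r \<open>r \<in> \<R> i\<close>
      by (simp add: act_homogeneous scale_smult scale_scale MG.homogeneous_closed mult.commute)
  qed (use r in \<open>simp add: act_add_right scale_add RG.homogeneous_closed\<close>)
qed (simp add: act_add_left scale_add smult_r_distr)

lemma act_smult_right:
  assumes "x \<in> carrier R" "m \<in> carrier M"
  shows "act x (scale a m) = scale a (act x m)"
  using assms
proof (induction x rule: RG.homogeneous_induct)
  case (homogeneous i r)
  then have r: "r \<in> carrier R" by (simp add: RG.homogeneous_closed)
  show ?case
    using homogeneous(3)
  proof (induction m rule: MG.homogeneous_induct)
    case (homogeneous j v)
    then show ?case
      using r \<open>r \<in> \<R> i\<close>
      by (simp add: act_homogeneous[OF _ scale_homogeneous] act_homogeneous smult_scale scale_scale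
          MG.homogeneous_closed mult.commute)
  qed (use r in \<open>simp add: act_add_right scale_add\<close>)
qed (simp add: act_add_left scale_add)

end

text \<open>\<open>R\<close> as a module over itself. Its scalar ring is \<open>R\<close> instead of the complex numbers, so its
  record has another type than \<open>R\<close>.\<close>

definition regular_module :: "('k, 'r) module \<Rightarrow> ('r, 'r) module" where
  "regular_module R = \<lparr>carrier = carrier R, monoid.mult = monoid.mult R, one = \<one>\<^bsub>R\<^esub>,
     ring.zero = \<zero>\<^bsub>R\<^esub>, add = add R, module.smult = monoid.mult R\<rparr>"

lemma regular_module_simps [simp]:
  "carrier (regular_module R) = carrier R" "\<zero>\<^bsub>regular_module R\<^esub> = \<zero>\<^bsub>R\<^esub>"
  "add (regular_module R) = add R" "module.smult (regular_module R) = monoid.mult R"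
  "a_inv (regular_module R) = a_inv R" "a_minus (regular_module R) = a_minus R"
  by (simp_all add: regular_module_def a_inv_def a_minus_def m_inv_def fun_eq_iff)

lemma additive_subgroup_regular_module:
  "additive_subgroup W (regular_module R) \<longleftrightarrow> additive_subgroup W R"
  by (simp add: additive_subgroup_def subgroup_def m_inv_def)

lemma finsum_regular_module [simp]: "finsum (regular_module R) = finsum R"
  by (simp add: finsum_def finprod_def fun_eq_iff)

lemma decomposition_regular_module [simp]:
  "decomposition (regular_module R) \<G> = decomposition R \<G>"
  by (simp add: decomposition_def fun_eq_iff)

lemma direct_sum_regular_module: "direct_sum (regular_module R) \<G> \<longleftrightarrow> direct_sum R \<G>"
  unfolding direct_sum_def additive_subgroup_def[symmetric] additive_subgroup_regular_module
  by simp

lemma component_regular_module [simp]: "component (regular_module R) \<G> = component R \<G>"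
  by (simp add: component_def decomposition_def fun_eq_iff)

lemma degrees_regular_module [simp]: "degrees (regular_module R) \<G> = degrees R \<G>"
  by (simp add: degrees_def fun_eq_iff)

lemma degree_ge_regular_module [simp]: "degree_ge (regular_module R) \<G> = degree_ge R \<G>"
  by (simp add: degree_ge_def fun_eq_iff)

lemma module_regular_module:
  fixes R :: "('k, 'r) module"
  assumes "cring R"
  shows "module R (regular_module R)"
proof -
  interpret cring R by (rule assms)
  show ?thesis
  proof (rule moduleI)
    show "abelian_group (regular_module R)"
      by (rule abelian_groupI) (auto simp: a_ac intro: l_neg)
  qed (auto simp: l_distr r_distr m_assoc is_cring)
qed

lemma complex_graded_module_regular_module:
  assumes "graded_algebra complex_field R \<R>"
  shows "complex_graded_module R \<R> (regular_module R) \<R>"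
proof -
  interpret graded_algebra complex_field R \<R> by (rule assms)
  show ?thesis
    using R_direct_sum R_mult
    by (intro complex_graded_module.intro graded_module.intro graded_module_axioms.intro assms
        module_regular_module M_cring) (auto simp: direct_sum_regular_module)
qed

context euler_module
begin

text \<open>With \<open>\<lambda> = 0\<close> and \<open>\<mu> = \<kappa>\<close> the scalar of the action is \<open>\<kappa> (deg r - deg s)\<close>, the scalar of the
  bracket.\<close>

sublocale Reg: euler_module R \<R> "regular_module R" \<R> \<kappa> 0 \<kappa>
  by (intro euler_module.intro complex_graded_module_regular_module graded_algebra_axioms)

abbreviation br :: "'r \<Rightarrow> 'r \<Rightarrow> 'r" where
  "br \<equiv> euler_bracket \<kappa> R \<R>"

lemma regular_scale: "r \<in> carrier R \<Longrightarrow> Reg.scale a r = a \<odot>\<^bsub>R\<^esub> r"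
  by (simp add: Reg.scale_def emb_mult)

lemma br_eq_act:
  assumes "r \<in> carrier R" "s \<in> carrier R"
  shows "br r s = Reg.act r s"
  unfolding euler_bracket_def euler_action_def
  using assms by (simp add: regular_scale algebra_simps cong: M.finsum_cong)

lemma br_closed [simp]: "r \<in> carrier R \<Longrightarrow> s \<in> carrier R \<Longrightarrow> br r s \<in> carrier R"
  using Reg.act_closed by (simp add: br_eq_act)

lemma br_add_left: "\<lbrakk>x \<in> carrier R; y \<in> carrier R; z \<in> carrier R\<rbrakk> \<Longrightarrow>
    br (x \<oplus>\<^bsub>R\<^esub> y) z = br x z \<oplus>\<^bsub>R\<^esub> br y z"
  using Reg.act_add_left by (simp add: br_eq_act)

lemma br_add_right: "\<lbrakk>x \<in> carrier R; y \<in> carrier R; z \<in> carrier R\<rbrakk> \<Longrightarrow>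
    br x (y \<oplus>\<^bsub>R\<^esub> z) = br x y \<oplus>\<^bsub>R\<^esub> br x z"
  using Reg.act_add_right by (simp add: br_eq_act)

lemma br_homogeneous: "r \<in> \<R> i \<Longrightarrow> s \<in> \<R> j \<Longrightarrow>
    br r s = (\<kappa> * (of_nat i - of_nat j)) \<odot>\<^bsub>R\<^esub> (r \<otimes>\<^bsub>R\<^esub> s)"
  by (rule euler_bracket_homogeneous[OF graded_algebra_axioms])

lemma R_scale: "r \<in> \<R> i \<Longrightarrow> a \<odot>\<^bsub>R\<^esub> r \<in> \<R> i"
  using submodule.smult_closed[OF R_submodule] by simp

lemma br_antisym:
  assumes "r \<in> carrier R" "s \<in> carrier R"
  shows "br r s \<oplus>\<^bsub>R\<^esub> br s r = \<zero>\<^bsub>R\<^esub>"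
  using assms
proof (induction r rule: RG.homogeneous_induct)
  case (homogeneous i r)
  show ?case
    using homogeneous(3)
  proof (induction s rule: RG.homogeneous_induct)
    case hs: (homogeneous j s)
    have rs: "r \<in> carrier R" "s \<in> carrier R"
      using homogeneous(2) hs(2) RG.homogeneous_closed by auto
    then have "br r s \<oplus>\<^bsub>R\<^esub> br s r =
        (\<kappa> * (of_nat i - of_nat j) + \<kappa> * (of_nat j - of_nat i)) \<odot>\<^bsub>R\<^esub> (r \<otimes>\<^bsub>R\<^esub> s)"
      using smult_l_distr[of "\<kappa> * (of_nat i - of_nat j)" "\<kappa> * (of_nat j - of_nat i)" "r \<otimes>\<^bsub>R\<^esub> s"]
      by (simp add: br_homogeneous[OF homogeneous(2) hs(2)] br_homogeneous[OF hs(2) homogeneous(2)]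
          m_comm[of s r])
    also have "\<dots> = \<zero>\<^bsub>R\<^esub>"
      using rs smult_l_null[of "r \<otimes>\<^bsub>R\<^esub> s"] by (simp add: algebra_simps)
    finally show ?case .
  next
    case (add x y)
    have "br r (x \<oplus>\<^bsub>R\<^esub> y) \<oplus>\<^bsub>R\<^esub> br (x \<oplus>\<^bsub>R\<^esub> y) r =
        (br r x \<oplus>\<^bsub>R\<^esub> br x r) \<oplus>\<^bsub>R\<^esub> (br r y \<oplus>\<^bsub>R\<^esub> br y r)"
      using add RG.homogeneous_closed[OF homogeneous(2)]
      by (simp add: br_add_left br_add_right M.a_ac)
    then show ?case using add by simp
  qed
next
  case (add x y)
  have "br (x \<oplus>\<^bsub>R\<^esub> y) s \<oplus>\<^bsub>R\<^esub> br s (x \<oplus>\<^bsub>R\<^esub> y) =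
      (br x s \<oplus>\<^bsub>R\<^esub> br s x) \<oplus>\<^bsub>R\<^esub> (br y s \<oplus>\<^bsub>R\<^esub> br s y)"
    using add by (simp add: br_add_left br_add_right M.a_ac)
  then show ?case using add by simp
qed

text \<open>Antisymmetry gives \<open>2 [r, r] = 0\<close>, and 2 is invertible.\<close>

lemma br_self:
  assumes "r \<in> carrier R"
  shows "br r r = \<zero>\<^bsub>R\<^esub>"
proof -
  have "br r r = (1/2 + 1/2) \<odot>\<^bsub>R\<^esub> br r r"
    using assms smult_one[of "br r r"] by simp
  also have "\<dots> = (1/2) \<odot>\<^bsub>R\<^esub> (br r r \<oplus>\<^bsub>R\<^esub> br r r)"
    using assms smult_l_distr[of "1/2" "1/2" "br r r"] smult_r_distr[of "1/2" "br r r" "br r r"]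
    by simp
  also have "\<dots> = \<zero>\<^bsub>R\<^esub>"
    using assms br_antisym smult_r_null by simp
  finally show ?thesis .
qed

text \<open>Written without subtraction, both sides are additive in each of \<open>x\<close>, \<open>y\<close>, \<open>m\<close>. For homogeneous
  elements of degrees \<open>i\<close>, \<open>j\<close>, \<open>k\<close> both sides are multiples of \<open>x (y m)\<close>, and the two scalars agree.\<close>

lemma act_br_add:
  assumes "x \<in> carrier R" "y \<in> carrier R" "m \<in> carrier M"
  shows "act (br x y) m \<oplus>\<^bsub>M\<^esub> act y (act x m) = act x (act y m)"
  using assms
proof (induction x rule: RG.homogeneous_induct)
  case hx: (homogeneous i x)
  then have x: "x \<in> carrier R" by (simp add: RG.homogeneous_closed)
  show ?case
    using hx(3)
  proof (induction y rule: RG.homogeneous_induct)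
    case hy: (homogeneous j y)
    then have y: "y \<in> carrier R" by (simp add: RG.homogeneous_closed)
    show ?case
      using assms(3)
    proof (induction m rule: MG.homogeneous_induct)
      case hm: (homogeneous k m)
      then have m: "m \<in> carrier M" by (simp add: MG.homogeneous_closed)
      have xm: "scale a (x \<odot>\<^bsub>M\<^esub> m) \<in> \<M> (i + k)" and ym: "scale a (y \<odot>\<^bsub>M\<^esub> m) \<in> \<M> (j + k)" for a
        using hx(2) hy(2) hm(2) by (auto intro: scale_homogeneous M_smult)
      have xy: "a \<odot>\<^bsub>R\<^esub> (x \<otimes>\<^bsub>R\<^esub> y) \<in> \<R> (i + j)" for a
        using hx(2) hy(2) by (auto intro: R_scale R_mult)
      have c: "\<kappa> * (of_nat i - of_nat j) * coef (i + j) k + coef i k * coef j (i + k)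
          = coef j k * coef i (j + k)"
        by (simp add: algebra_simps)
      have "act (br x y) m = scale (\<kappa> * (of_nat i - of_nat j) * coef (i + j) k) (x \<odot>\<^bsub>M\<^esub> (y \<odot>\<^bsub>M\<^esub> m))"
        using x y m by (simp add: br_homogeneous[OF hx(2) hy(2)] act_homogeneous[OF xy hm(2)]
            scale_smult scale_scale Mod.smult_assoc1 mult.commute)
      moreover have "act y (act x m) = scale (coef i k * coef j (i + k)) (x \<odot>\<^bsub>M\<^esub> (y \<odot>\<^bsub>M\<^esub> m))"
        using x y m by (simp add: act_homogeneous[OF hx(2) hm(2)] act_homogeneous[OF hy(2) xm]
            smult_scale scale_scale Mod.smult_assoc1[symmetric] m_comm[of y x] mult.commute)
      moreover have "act x (act y m) = scale (coef j k * coef i (j + k)) (x \<odot>\<^bsub>M\<^esub> (y \<odot>\<^bsub>M\<^esub> m))"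
        using x y m by (simp add: act_homogeneous[OF hy(2) hm(2)] act_homogeneous[OF hx(2) ym]
            smult_scale scale_scale mult.commute)
      ultimately show ?case
        using x y m scale_plus[of "x \<odot>\<^bsub>M\<^esub> (y \<odot>\<^bsub>M\<^esub> m)"
            "\<kappa> * (of_nat i - of_nat j) * coef (i + j) k" "coef i k * coef j (i + k)", unfolded c]
        by (simp only: Mod.smult_closed)
    next
      case (add m n)
      have "act (br x y) (m \<oplus>\<^bsub>M\<^esub> n) \<oplus>\<^bsub>M\<^esub> act y (act x (m \<oplus>\<^bsub>M\<^esub> n)) =
          (act (br x y) m \<oplus>\<^bsub>M\<^esub> act y (act x m)) \<oplus>\<^bsub>M\<^esub> (act (br x y) n \<oplus>\<^bsub>M\<^esub> act y (act x n))"
        using x y add(1,2) by (simp add: act_add_right Mod.M.a_ac)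
      then show ?case using add x y by (simp add: act_add_right)
    qed
  next
    case (add y z)
    have "act (br x (y \<oplus>\<^bsub>R\<^esub> z)) m \<oplus>\<^bsub>M\<^esub> act (y \<oplus>\<^bsub>R\<^esub> z) (act x m) =
        (act (br x y) m \<oplus>\<^bsub>M\<^esub> act y (act x m)) \<oplus>\<^bsub>M\<^esub> (act (br x z) m \<oplus>\<^bsub>M\<^esub> act z (act x m))"
      using x add(1,2) assms(3) by (simp add: act_add_left br_add_right Mod.M.a_ac)
    then show ?case using add x assms(3) by (simp add: act_add_left act_add_right)
  qed
next
  case (add x z)
  have "act (br (x \<oplus>\<^bsub>R\<^esub> z) y) m \<oplus>\<^bsub>M\<^esub> act y (act (x \<oplus>\<^bsub>R\<^esub> z) m) =
      (act (br x y) m \<oplus>\<^bsub>M\<^esub> act y (act x m)) \<oplus>\<^bsub>M\<^esub> (act (br z y) m \<oplus>\<^bsub>M\<^esub> act y (act z m))"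
    using add(1,2) assms(2,3) by (simp add: act_add_left act_add_right br_add_left Mod.M.a_ac)
  then show ?case using add by (simp add: act_add_left)
qed

lemma act_br:
  assumes "x \<in> carrier R" "y \<in> carrier R" "m \<in> carrier M"
  shows "act (br x y) m = act x (act y m) \<ominus>\<^bsub>M\<^esub> act y (act x m)"
  unfolding act_br_add[OF assms, symmetric]
  using assms by (simp add: Mod.M.minus_eq Mod.M.a_assoc Mod.M.r_neg)

end

(* The context is reopened to apply act_br_add to the action of R on itself. *)
context euler_module
begin

text \<open>For the action of \<open>R\<close> on itself, \<open>act_br_add\<close> reads \<open>[[x, y], z] + [y, [x, z]] = [x, [y, z]]\<close>, which
  is the Jacobi identity up to antisymmetry.\<close>

lemma br_jacobi:
  assumes "x \<in> carrier R" "y \<in> carrier R" "z \<in> carrier R"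
  shows "br x (br y z) \<oplus>\<^bsub>R\<^esub> br y (br z x) \<oplus>\<^bsub>R\<^esub> br z (br x y) = \<zero>\<^bsub>R\<^esub>"
proof -
  have "br (br x y) z \<oplus>\<^bsub>R\<^esub> br y (br x z) = br x (br y z)"
    using Reg.act_br_add[of x y z] assms by (simp flip: br_eq_act)
  then have "br x (br y z) \<oplus>\<^bsub>R\<^esub> br y (br z x) \<oplus>\<^bsub>R\<^esub> br z (br x y) =
      (br (br x y) z \<oplus>\<^bsub>R\<^esub> br z (br x y)) \<oplus>\<^bsub>R\<^esub> br y (br x z \<oplus>\<^bsub>R\<^esub> br z x)"
    using assms by (simp add: br_add_right M.a_ac flip: \<open>_ = br x (br y z)\<close>)
  also have "\<dots> = \<zero>\<^bsub>R\<^esub>"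
    using assms br_add_right[of y "\<zero>\<^bsub>R\<^esub>" "\<zero>\<^bsub>R\<^esub>"] M.add.l_cancel_one'[of "br y \<zero>\<^bsub>R\<^esub>" "br y \<zero>\<^bsub>R\<^esub>"]
    by (simp add: br_antisym)
  finally show ?thesis .
qed

lemma br_smult_left: "x \<in> carrier R \<Longrightarrow> y \<in> carrier R \<Longrightarrow>
    br (a \<odot>\<^bsub>R\<^esub> x) y = a \<odot>\<^bsub>R\<^esub> br x y"
  using Reg.act_smult_left[of x y a] by (simp add: regular_scale flip: br_eq_act)

lemma br_smult_right: "x \<in> carrier R \<Longrightarrow> y \<in> carrier R \<Longrightarrow>
    br x (a \<odot>\<^bsub>R\<^esub> y) = a \<odot>\<^bsub>R\<^esub> br x y"
  using Reg.act_smult_right[of x y a] by (simp add: regular_scale flip: br_eq_act)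

lemma lie_module_degree_ge:
  "lie_module complex_field (R\<lparr>carrier := degree_ge R \<R> N\<rparr>) br
    ((restrict_scalars R M)\<lparr>carrier := degree_ge M \<M> N\<rparr>) act"
proof -
  have R: "x \<in> carrier R" if "x \<in> degree_ge R \<R> N" for x
    using that by (simp add: degree_ge_def)
  have M: "x \<in> carrier M" if "x \<in> degree_ge M \<M> N" for x
    using that by (simp add: degree_ge_def)
  have a_minus: "x \<ominus>\<^bsub>(restrict_scalars R M)\<lparr>carrier := degree_ge M \<M> N\<rparr>\<^esub> y = x \<ominus>\<^bsub>M\<^esub> y"
    if "y \<in> degree_ge M \<M> N" for x y
  proof -
    let ?V = "(restrict_scalars R M)\<lparr>carrier := degree_ge M \<M> N\<rparr>"
    have "a_inv ?V y = a_inv (restrict_scalars R M) y"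
      using group.m_inv_consistent[OF C.M.a_group submodule.axioms(1)[OF degree_ge_submodule[of N]] that]
      by (simp add: a_inv_def del: restrict_scalars_simps)
    then show ?thesis by (simp add: a_minus_def)
  qed
  have S: "submodule (degree_ge R \<R> N) complex_field R"
  proof (intro submodule.intro submodule_axioms.intro)
    show "subgroup (degree_ge R \<R> N) (add_monoid R)"
      using RG.degree_ge_subgroup by (simp add: additive_subgroup_def)
    show "a \<odot>\<^bsub>R\<^esub> x \<in> degree_ge R \<R> N" if "x \<in> degree_ge R \<R> N" for a x
      using submodule.smult_closed[OF Reg.degree_ge_submodule, of a x N] that
      by (simp add: regular_scale R)
  qed
  have closed: "act x m \<in> degree_ge M \<M> N"
    if "x \<in> degree_ge R \<R> N" "m \<in> degree_ge M \<M> N" for x m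
    using act_in_degree_ge[OF that] MG.degree_ge_antimono[of N "N + N"] by auto
  have br_in: "br x y \<in> degree_ge R \<R> N"
    if "x \<in> degree_ge R \<R> N" "y \<in> degree_ge R \<R> N" for x y
    using Reg.act_in_degree_ge[of x N y N] that RG.degree_ge_antimono[of N "N + N"]
    by (auto simp: br_eq_act R)
  show ?thesis
    by (intro lie_module.intro lie_algebra.intro lie_algebra_axioms.intro lie_module_axioms.intro
        submodule.submodule_is_module[OF S] submodule.submodule_is_module[OF degree_ge_submodule]
        module C.module_axioms)
      (simp_all add: R M closed br_in br_add_left br_add_right act_add_left act_add_right br_self
      br_jacobi act_smult_left act_smult_right a_minus act_br br_smult_left br_smult_right)
qed

end

section \<open>Generation in a single degree\<close>

definition contains_multiples :: "(nat \<Rightarrow> 'r set) \<Rightarrow> ('r, 'm) module \<Rightarrow> (nat \<times> 'm) set \<Rightarrow> nat \<Rightarrow> 'm set \<Rightarrow> bool"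
  where "contains_multiples \<R> M Y n W \<longleftrightarrow> additive_subgroup W M \<and>
    (\<forall>(k, y) \<in> Y. k \<le> n \<longrightarrow> (\<forall>s \<in> \<R> (n - k). s \<odot>\<^bsub>M\<^esub> y \<in> W))"

text \<open>The inclusion \<open>M\<^sub>n \<subseteq> \<Sum>\<^bsub>(k, y) \<in> Y\<^esub> R\<^bsub>n-k\<^esub> y\<close>, expressed without the sum: every additive subgroup containing the products contains \<open>M\<^sub>n\<close>. In this form such statements
  compose by passing to preimages of subgroups under multiplication by a fixed element. Each element
  of \<open>Y\<close> carries its degree as first component.\<close>

definition generates_degree :: "(nat \<Rightarrow> 'r set) \<Rightarrow> ('r, 'm) module \<Rightarrow> (nat \<Rightarrow> 'm set)
    \<Rightarrow> (nat \<times> 'm) set \<Rightarrow> nat \<Rightarrow> bool" where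
  "generates_degree \<R> M \<M> Y n \<longleftrightarrow> (\<forall>W. contains_multiples \<R> M Y n W \<longrightarrow> \<M> n \<subseteq> W)"

text \<open>A finite spanning set of the complex vector space \<open>M\<^sub>n\<close>.\<close>

definition spans_degree :: "(complex, 'r) module \<Rightarrow> ('r, 'm) module \<Rightarrow> (nat \<Rightarrow> 'm set)
    \<Rightarrow> nat \<Rightarrow> 'm set \<Rightarrow> bool" where
  "spans_degree R M \<M> n F \<longleftrightarrow> finite F \<and> F \<subseteq> \<M> n \<and>
    (\<forall>W. submodule W complex_field (restrict_scalars R M) \<and> F \<subseteq> W \<longrightarrow> \<M> n \<subseteq> W)"

definition finite_dim_degree :: "(complex, 'r) module \<Rightarrow> ('r, 'm) module \<Rightarrow> (nat \<Rightarrow> 'm set)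
    \<Rightarrow> nat \<Rightarrow> bool" where
  "finite_dim_degree R M \<M> n \<longleftrightarrow> (\<exists>F. spans_degree R M \<M> n F)"

definition homogeneous_parts :: "('m, 'c) ring_scheme \<Rightarrow> (nat \<Rightarrow> 'm set) \<Rightarrow> 'm set \<Rightarrow> (nat \<times> 'm) set" where
  "homogeneous_parts M \<M> S = (\<Union>x\<in>S. (\<lambda>k. (k, component M \<M> k x)) ` degrees M \<M> x)"

lemma (in graded_group) finite_homogeneous_parts:
  "finite S \<Longrightarrow> S \<subseteq> carrier A \<Longrightarrow> finite (homogeneous_parts A \<G> S)"
  unfolding homogeneous_parts_def by (auto intro: finite_degrees)

lemma (in graded_group) homogeneous_parts_in:
  "S \<subseteq> carrier A \<Longrightarrow> (k, y) \<in> homogeneous_parts A \<G> S \<Longrightarrow> y \<in> \<G> k"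
  unfolding homogeneous_parts_def by auto

context complex_graded_module
begin

lemma preimage_smult:
  assumes W: "additive_subgroup W M" and r: "r \<in> carrier R"
  shows "additive_subgroup {t \<in> carrier M. r \<odot>\<^bsub>M\<^esub> t \<in> W} M"
proof -
  interpret W: additive_subgroup W M by (rule W)
  show ?thesis
    using r by (intro Mod.M.additive_subgroup_if_closed) (auto simp: Mod.smult_r_distr Mod.smult_r_minus)
qed

lemma preimage_smult_elem:
  assumes W: "additive_subgroup W M" and m: "m \<in> carrier M"
  shows "additive_subgroup {s \<in> carrier R. s \<odot>\<^bsub>M\<^esub> m \<in> W} R"
proof -
  interpret W: additive_subgroup W M by (rule W)
  show ?thesis
    using m by (intro M.additive_subgroup_if_closed) (auto simp: Mod.smult_l_distr Mod.smult_l_minus)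
qed

text \<open>The elements all of whose components in the degrees \<open>n \<in> D\<close> lie in \<open>\<Sum>\<^bsub>(k, y) \<in> Y\<^esub> R\<^bsub>n-k\<^esub> y\<close>. To see that \<open>Y\<close>
  generates in the degrees of \<open>D\<close>, one shows that this set has enough closure properties to be
  everything. All degrees are used for modules, the positive ones for algebras.\<close>

definition homogeneous_span :: "nat set \<Rightarrow> (nat \<times> 'm) set \<Rightarrow> 'm set" where
  "homogeneous_span D Y = {m \<in> carrier M. \<forall>n \<in> D. \<forall>W. contains_multiples \<R> M Y n W \<longrightarrow> MG.part n m \<in> W}"

lemma homogeneous_span_subgroup: "additive_subgroup (homogeneous_span D Y) M"
proof (rule Mod.M.additive_subgroup_if_closed)
  have W: "additive_subgroup W M" if "contains_multiples \<R> M Y n W" for n W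
    using that by (simp add: contains_multiples_def)
  show "homogeneous_span D Y \<subseteq> carrier M" by (auto simp: homogeneous_span_def)
  show "\<zero>\<^bsub>M\<^esub> \<in> homogeneous_span D Y"
    using additive_subgroup.zero_closed[OF W] by (simp add: homogeneous_span_def)
  show "x \<oplus>\<^bsub>M\<^esub> y \<in> homogeneous_span D Y" if "x \<in> homogeneous_span D Y" "y \<in> homogeneous_span D Y" for x y
    using that additive_subgroup.a_closed[OF W] by (simp add: homogeneous_span_def MG.part_add)
  show "\<ominus>\<^bsub>M\<^esub> x \<in> homogeneous_span D Y" if "x \<in> homogeneous_span D Y" for x
    using that Mod.M.additive_subgroup_minus[OF W] by (simp add: homogeneous_span_def MG.part_minus)
qed

text \<open>If \<open>t\<close> is a combination of generators in degree \<open>n - i\<close> and \<open>r\<close> has degree \<open>i\<close>, then \<open>r t\<close> is one in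
  degree \<open>n\<close>.\<close>

lemma contains_multiples_shift:
  assumes Y: "\<And>k y. (k, y) \<in> Y \<Longrightarrow> y \<in> \<M> k" and W: "contains_multiples \<R> M Y n W"
    and r: "r \<in> \<R> i" and i: "i \<le> n"
  shows "contains_multiples \<R> M Y (n - i) {t \<in> carrier M. r \<odot>\<^bsub>M\<^esub> t \<in> W}"
  unfolding contains_multiples_def
proof (safe intro!: preimage_smult)
  show "additive_subgroup W M" using W by (simp add: contains_multiples_def)
  show rR: "r \<in> carrier R" using r by (rule RG.homogeneous_closed)
  fix k y s assume ky: "(k, y) \<in> Y" "k \<le> n - i" and s: "s \<in> \<R> (n - i - k)"
  have yM: "y \<in> carrier M" using Y ky(1) MG.homogeneous_closed by blast
  have sR: "s \<in> carrier R" using s by (rule RG.homogeneous_closed)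
  show "s \<odot>\<^bsub>M\<^esub> y \<in> carrier M" using sR yM by simp
  have "i + (n - i - k) = n - k" using ky(2) i by simp
  then have "r \<otimes>\<^bsub>R\<^esub> s \<in> \<R> (n - k)" using R_mult[OF r s] by simp
  then have "(r \<otimes>\<^bsub>R\<^esub> s) \<odot>\<^bsub>M\<^esub> y \<in> W"
    using W ky i unfolding contains_multiples_def by fastforce
  then show "r \<odot>\<^bsub>M\<^esub> (s \<odot>\<^bsub>M\<^esub> y) \<in> W" using rR sR yM by (simp add: Mod.smult_assoc1)
qed

lemma generates_degree_if_span:
  assumes "homogeneous_span D Y = carrier M" "n \<in> D"
  shows "generates_degree \<R> M \<M> Y n"
  unfolding generates_degree_def
proof (intro allI impI subsetI)
  fix W m assume W: "contains_multiples \<R> M Y n W" and m: "m \<in> \<M> n"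
  have "m \<in> homogeneous_span D Y"
    using assms(1) MG.homogeneous_closed[OF m] by simp
  then have "MG.part n m \<in> W"
    using assms(2) W unfolding homogeneous_span_def by blast
  then show "m \<in> W" using MG.part_homogeneous[OF m] by simp
qed

lemma parts_in_homogeneous_span:
  assumes x: "x \<in> carrier M"
    and Y: "\<And>n. n \<in> D \<Longrightarrow> n \<in> degrees M \<M> x \<Longrightarrow> (n, MG.part n x) \<in> Y"
  shows "x \<in> homogeneous_span D Y"
  unfolding homogeneous_span_def
proof safe
  show "x \<in> carrier M" by (rule x)
  fix n W assume n: "n \<in> D" and W: "contains_multiples \<R> M Y n W"
  show "MG.part n x \<in> W"
  proof (cases "n \<in> degrees M \<M> x")
    case True
    then have "\<one>\<^bsub>R\<^esub> \<odot>\<^bsub>M\<^esub> MG.part n x \<in> W"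
      using W Y[OF n True] R_one unfolding contains_multiples_def by fastforce
    then show ?thesis using x by simp
  next
    case False
    then show ?thesis
      using W additive_subgroup.zero_closed[of W M] by (simp add: degrees_def contains_multiples_def)
  qed
qed

text \<open>The components of finitely many generators generate, and they do so degree by degree: the set
  \<open>homogeneous_span\<close> they define is a submodule, and it contains the given generators.\<close>

lemma finite_homogeneous_module_generators:
  assumes "finitely_generated_module R M"
  obtains Y where "finite Y" "\<And>k y. (k, y) \<in> Y \<Longrightarrow> y \<in> \<M> k" "\<And>n. generates_degree \<R> M \<M> Y n"
proof -
  obtain S where S: "finite S" "S \<subseteq> carrier M"
    and gen: "\<And>W. submodule W R M \<Longrightarrow> S \<subseteq> W \<Longrightarrow> W = carrier M"
    using assms unfolding finitely_generated_module_def by blast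
  let ?Y = "homogeneous_parts M \<M> S"
  let ?J = "homogeneous_span UNIV ?Y"
  note Y = MG.homogeneous_parts_in[OF S(2)]
  interpret J: additive_subgroup ?J M by (rule homogeneous_span_subgroup)
  have "submodule ?J R M"
  proof (intro submodule.intro submodule_axioms.intro J.a_subgroup)
    fix r m assume "r \<in> carrier R" and m: "m \<in> ?J"
    then have mM: "m \<in> carrier M" by (simp add: J.a_Hcarr)
    from \<open>r \<in> carrier R\<close> show "r \<odot>\<^bsub>M\<^esub> m \<in> ?J"
    proof (induction r rule: RG.homogeneous_induct)
      case (homogeneous i r)
      then have rR: "r \<in> carrier R" by (simp add: RG.homogeneous_closed)
      have "MG.part n (r \<odot>\<^bsub>M\<^esub> m) \<in> W" if W: "contains_multiples \<R> M ?Y n W" for n W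
      proof (cases "i \<le> n")
        case True
        have "MG.part (n - i) m \<in> {t \<in> carrier M. r \<odot>\<^bsub>M\<^esub> t \<in> W}"
          using m contains_multiples_shift[OF Y W homogeneous(2) True]
          by (auto simp only: homogeneous_span_def)
        then show ?thesis using True part_smult[OF homogeneous(2) mM] by simp
      next
        case False
        then show ?thesis
          using W additive_subgroup.zero_closed[of W M] part_smult[OF homogeneous(2) mM]
          by (simp add: contains_multiples_def)
      qed
      moreover have "r \<odot>\<^bsub>M\<^esub> m \<in> carrier M" using rR mM by simp
      ultimately show ?case unfolding homogeneous_span_def by blast
    qed (use mM in \<open>simp add: Mod.smult_l_distr\<close>)
  qed
  moreover have "S \<subseteq> ?J"
  proof
    fix x assume "x \<in> S"
    with S(2) show "x \<in> ?J"
      by (intro parts_in_homogeneous_span) (auto simp: homogeneous_parts_def)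
  qed
  ultimately have "?J = carrier M" by (rule gen)
  then have gen_n: "generates_degree \<R> M \<M> ?Y n" for n
    using generates_degree_if_span by simp
  show ?thesis
    by (rule that[OF MG.finite_homogeneous_parts[OF S] Y gen_n])
qed

text \<open>If \<open>M\<^sub>n = \<Sum> R\<^bsub>n-k\<^esub> y\<close> is a finite sum, the products of spanning sets of the \<open>R\<^bsub>n-k\<^esub>\<close> with the \<open>y\<close> span
  \<open>M\<^sub>n\<close>. Used for \<open>R\<close> itself this is the induction step in \<open>finite_dim_degree_algebra\<close>; used for \<open>M\<close>
  it passes from \<open>R\<close> to \<open>M\<close>.\<close>

lemma finite_dim_step:
  assumes gen: "generates_degree \<R> M \<M> Y n" and Y: "finite Y" "\<And>k y. (k, y) \<in> Y \<Longrightarrow> y \<in> \<M> k"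
    and fd: "\<And>k y. (k, y) \<in> Y \<Longrightarrow> k \<le> n \<Longrightarrow> finite_dim_degree R (regular_module R) \<R> (n - k)"
  shows "finite_dim_degree R M \<M> n"
proof -
  have RS: "complex_graded_module R \<R> (regular_module R) \<R>"
    by (rule complex_graded_module_regular_module[OF graded_algebra_axioms])
  interpret Reg: complex_graded_module R \<R> "regular_module R" \<R> by (rule RS)
  let ?Y = "{(k, y) \<in> Y. k \<le> n}"
  define F where "F k = (SOME F. spans_degree R (regular_module R) \<R> (n - k) F)" for k
  have F: "spans_degree R (regular_module R) \<R> (n - k) (F k)" if "(k, y) \<in> Y" "k \<le> n" for k y
    unfolding F_def using fd[OF that] unfolding finite_dim_degree_def by (rule someI_ex)
  define E where "E = (\<Union>(k, y) \<in> ?Y. (\<lambda>s. s \<odot>\<^bsub>M\<^esub> y) ` F k)"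
  have "finite ?Y" using Y(1) by (rule rev_finite_subset) auto
  then have "finite E" unfolding E_def using F by (auto simp: spans_degree_def)
  moreover have "E \<subseteq> \<M> n"
  proof
    fix e assume "e \<in> E"
    then obtain k y s where *: "(k, y) \<in> Y" "k \<le> n" "s \<in> F k" "e = s \<odot>\<^bsub>M\<^esub> y"
      unfolding E_def by auto
    then have "s \<in> \<R> (n - k)" using F by (auto simp: spans_degree_def)
    from M_smult[OF this Y(2)[OF *(1)]] show "e \<in> \<M> n" using * by simp
  qed
  moreover have "\<M> n \<subseteq> W" if W: "submodule W complex_field (restrict_scalars R M)" and E: "E \<subseteq> W" for W
  proof -
    have Wg: "additive_subgroup W M"
      using submodule.axioms(1)[OF W] by (simp only: subgroup_restrict_scalars)
    have "s \<odot>\<^bsub>M\<^esub> y \<in> W" if ky: "(k, y) \<in> Y" "k \<le> n" and s: "s \<in> \<R> (n - k)" for k y s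
    proof -
      let ?U = "{s \<in> carrier R. s \<odot>\<^bsub>M\<^esub> y \<in> W}"
      have yM: "y \<in> carrier M" using Y(2)[OF ky(1)] by (rule MG.homogeneous_closed)
      have "submodule ?U complex_field (restrict_scalars R (regular_module R))"
      proof (intro submodule.intro submodule_axioms.intro)
        show "subgroup ?U (add_monoid (restrict_scalars R (regular_module R)))"
          unfolding subgroup_restrict_scalars additive_subgroup_regular_module
          by (rule preimage_smult_elem[OF Wg yM])
        fix a x assume x: "x \<in> ?U"
        have "scale a (x \<odot>\<^bsub>M\<^esub> y) \<in> W" using submodule.smult_closed[OF W] x by simp
        then show "Reg.scale a x \<in> ?U"
          using x yM by (simp add: Reg.scale_def emb_mult scale_smult)
      qed
      moreover have "F k \<subseteq> ?U"
      proof
        fix s assume s: "s \<in> F k"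
        then have "s \<in> \<R> (n - k)" using F[OF ky] by (auto simp: spans_degree_def)
        moreover have "s \<odot>\<^bsub>M\<^esub> y \<in> E" unfolding E_def using ky s by blast
        ultimately show "s \<in> ?U" using E RG.homogeneous_closed by blast
      qed
      ultimately have "\<R> (n - k) \<subseteq> ?U" using F[OF ky] by (simp add: spans_degree_def)
      then show ?thesis using s by blast
    qed
    then have "contains_multiples \<R> M Y n W"
      using Wg unfolding contains_multiples_def by auto
    then show ?thesis using gen unfolding generates_degree_def by blast
  qed
  ultimately show ?thesis unfolding finite_dim_degree_def spans_degree_def by blast
qed

end

section \<open>Generators of the graded algebra\<close>

context euler_module
begin

text \<open>Let \<open>I\<close> be the ideal generated by the positive-degree components of the ring generators. The elements
  whose components of positive degree all lie in \<open>I\<close> form a subring: if a product \<open>r\<^sub>i s\<^sub>j\<close> has degree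
  \<open>i + j \<ge> 1\<close>, then one of the two factors has positive degree. This subring contains \<open>R\<^sub>0\<close> and the ring
  generators, so it is \<open>R\<close>. In degree \<open>n\<close> the ideal \<open>I\<close> is \<open>\<Sum>\<^bsub>(k, x) \<in> Z\<^esub> R\<^bsub>n-k\<^esub> x\<close>.\<close>

lemma finite_homogeneous_algebra_generators:
  assumes "\<exists>S. finite S \<and> S \<subseteq> carrier R \<and> generate_ring R (\<R> 0 \<union> S) = carrier R"
  obtains Z where "finite Z" "\<And>k x. (k, x) \<in> Z \<Longrightarrow> 1 \<le> k \<and> x \<in> \<R> k"
    "\<And>n. 1 \<le> n \<Longrightarrow> generates_degree \<R> (regular_module R) \<R> Z n"
proof -
  obtain S where S: "finite S" "S \<subseteq> carrier R" and gen: "generate_ring R (\<R> 0 \<union> S) = carrier R"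
    using assms by blast
  define Z where "Z = {(k, x) \<in> homogeneous_parts R \<R> S. 1 \<le> k}"
  have Z: "x \<in> \<R> k" "1 \<le> k" if "(k, x) \<in> Z" for k x
    using that RG.homogeneous_parts_in[OF S(2)] unfolding Z_def by auto
  have finZ: "finite Z"
    using RG.finite_homogeneous_parts[OF S] by (rule rev_finite_subset) (auto simp: Z_def)
  let ?J = "Reg.homogeneous_span {1..} Z"
  have Jsub: "additive_subgroup ?J R"
    using Reg.homogeneous_span_subgroup by (simp only: additive_subgroup_regular_module)
  interpret J: additive_subgroup ?J R by (rule Jsub)
  have JI: "r \<in> ?J"
    if "r \<in> carrier R" "\<And>n W. 1 \<le> n \<Longrightarrow> contains_multiples \<R> (regular_module R) Z n W \<Longrightarrow> RG.part n r \<in> W" for r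
    using that unfolding Reg.homogeneous_span_def by auto
  have JD: "RG.part n r \<in> W"
    if "r \<in> ?J" "1 \<le> n" "contains_multiples \<R> (regular_module R) Z n W" for r n W
    using that unfolding Reg.homogeneous_span_def by auto
  have W0: "\<zero>\<^bsub>R\<^esub> \<in> W" if "contains_multiples \<R> (regular_module R) Z n W" for n W
    using that additive_subgroup.zero_closed[of W "regular_module R"] by (simp add: contains_multiples_def)
  have R0: "r \<in> ?J" if "r \<in> \<R> 0" for r
    using that W0 by (intro JI) (auto simp: RG.part_homogeneous RG.homogeneous_closed)
  have hom: "r \<otimes>\<^bsub>R\<^esub> s \<in> ?J" if r: "r \<in> \<R> i" "r \<in> ?J" and s: "s \<in> ?J" for r s i
  proof (rule JI)
    have rR: "r \<in> carrier R" and sR: "s \<in> carrier R"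
      using r s by (auto simp: J.a_Hcarr)
    then show "r \<otimes>\<^bsub>R\<^esub> s \<in> carrier R" by simp
    fix n W assume n: "1 \<le> n" and W: "contains_multiples \<R> (regular_module R) Z n W"
    have part: "RG.part n (r \<otimes>\<^bsub>R\<^esub> s) = (if i \<le> n then r \<otimes>\<^bsub>R\<^esub> RG.part (n - i) s else \<zero>\<^bsub>R\<^esub>)"
      using Reg.part_smult[OF r(1), of s n] sR by simp
    \<comment> \<open>The component is \<open>r s\<^bsub>n-i\<^esub>\<close>. If \<open>n - i > 0\<close>, the generators come from \<open>s\<close>; if \<open>n = i\<close>, they come from \<open>r\<close>.\<close>
    consider "n < i" | "i < n" | "i = n" by linarith
    then show "RG.part n (r \<otimes>\<^bsub>R\<^esub> s) \<in> W"
    proof cases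
      case 1
      then show ?thesis using part W0[OF W] by simp
    next
      case 2
      then have "RG.part (n - i) s \<in> {t \<in> carrier R. r \<otimes>\<^bsub>R\<^esub> t \<in> W}"
        using JD[OF s _ Reg.contains_multiples_shift[OF Z(1) W r(1)]] by auto
      then show ?thesis using 2 part by simp
    next
      case 3
      let ?s = "RG.part 0 s" and ?U = "{t \<in> carrier R. t \<otimes>\<^bsub>R\<^esub> RG.part 0 s \<in> W}"
      have s0: "?s \<in> \<R> 0" "?s \<in> carrier R" using sR by auto
      have "contains_multiples \<R> (regular_module R) Z n ?U"
        unfolding contains_multiples_def
      proof (intro conjI ballI impI, safe)
        show "additive_subgroup ?U (regular_module R)"
          using Reg.preimage_smult_elem[of W ?s] W s0(2)
          by (simp add: contains_multiples_def additive_subgroup_regular_module)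
        fix k x t assume kx: "(k, x) \<in> Z" "k \<le> n" and t: "t \<in> \<R> (n - k)"
        have xR: "x \<in> carrier R" and tR: "t \<in> carrier R"
          using Z(1)[OF kx(1)] t RG.homogeneous_closed by auto
        then show "t \<odot>\<^bsub>regular_module R\<^esub> x \<in> carrier R" by simp
        have "t \<otimes>\<^bsub>R\<^esub> ?s \<in> \<R> (n - k)" using R_mult[OF t s0(1)] by simp
        then have "(t \<otimes>\<^bsub>R\<^esub> ?s) \<otimes>\<^bsub>R\<^esub> x \<in> W"
          using W kx unfolding contains_multiples_def by fastforce
        then show "(t \<odot>\<^bsub>regular_module R\<^esub> x) \<otimes>\<^bsub>R\<^esub> ?s \<in> W"
          using xR tR s0(2) by (simp add: m_ac)
      qed
      then have "RG.part n r \<in> ?U" using JD[OF r(2) n] by blast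
      then show ?thesis using 3 part RG.part_homogeneous[OF r(1), of n] by simp
    qed
  qed
  have mult: "r \<otimes>\<^bsub>R\<^esub> s \<in> ?J" if r: "r \<in> ?J" and s: "s \<in> ?J" for r s
  proof -
    have rR: "r \<in> carrier R" and sR: "s \<in> carrier R"
      using r s by (auto simp: J.a_Hcarr)
    let ?D = "degrees R \<R> r"
    have cin: "RG.part i r \<in> ?J" for i
      using rR JD[OF r] W0 by (intro JI) (auto simp: RG.part_homogeneous[OF RG.part_in])
    then have "(\<Oplus>\<^bsub>R\<^esub>i\<in>?D. RG.part i r \<otimes>\<^bsub>R\<^esub> s) \<in> ?J"
      by (intro M.finsum_in_additive_subgroup[OF Jsub] hom[OF RG.part_in[OF rR] cin s])
    also have "(\<Oplus>\<^bsub>R\<^esub>i\<in>?D. RG.part i r \<otimes>\<^bsub>R\<^esub> s) = (\<Oplus>\<^bsub>R\<^esub>i\<in>?D. RG.part i r) \<otimes>\<^bsub>R\<^esub> s"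
      using rR sR RG.finite_degrees by (intro finsum_ldistr[symmetric]) auto
    finally show ?thesis
      using RG.sum_part[OF rR RG.finite_degrees[OF rR]] by simp
  qed
  have SJ: "x \<in> ?J" if "x \<in> S" for x
    using that S(2) by (intro Reg.parts_in_homogeneous_span) (auto simp: homogeneous_parts_def Z_def)
  have "r \<in> ?J" if "r \<in> generate_ring R (\<R> 0 \<union> S)" for r
    using that
  proof induction
    case one
    show ?case by (rule R0[OF R_one])
  next
    case (incl h)
    then show ?case using R0 SJ by blast
  next
    case (a_inv h)
    show ?case by (rule M.additive_subgroup_minus[OF Jsub a_inv.IH])
  next
    case (eng_add h1 h2)
    show ?case by (rule J.a_closed[OF eng_add.IH])
  next
    case (eng_mult h1 h2)
    show ?case by (rule mult[OF eng_mult.IH])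
  qed
  then have "?J = carrier R"
    using gen J.a_subset by auto
  then have "generates_degree \<R> (regular_module R) \<R> Z n" if "1 \<le> n" for n
    using Reg.generates_degree_if_span[of "{1..}" Z n] that by simp
  from that[OF finZ _ this] Z show ?thesis by blast
qed

text \<open>Degree 0 is the hypothesis on \<open>R\<^sub>0\<close>. In positive degree the cofactors of the generators have smaller
  degree, because the generators have positive degree.\<close>

lemma finite_dim_degree_algebra:
  assumes R0: "finitely_generated_module complex_field (R\<lparr>carrier := \<R> 0\<rparr>)"
    and Z: "finite Z" "\<And>k x. (k, x) \<in> Z \<Longrightarrow> 1 \<le> k \<and> x \<in> \<R> k"
    and gen: "\<And>n. 1 \<le> n \<Longrightarrow> generates_degree \<R> (regular_module R) \<R> Z n"
  shows "finite_dim_degree R (regular_module R) \<R> n"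
proof (induction n rule: less_induct)
  case (less n)
  show ?case
  proof (cases "n = 0")
    case True
    obtain F where F: "finite F" "F \<subseteq> \<R> 0"
      and Fgen: "\<And>W. submodule W complex_field (R\<lparr>carrier := \<R> 0\<rparr>) \<Longrightarrow> F \<subseteq> W \<Longrightarrow> W = \<R> 0"
      using R0 unfolding finitely_generated_module_def by auto
    have M0: "module complex_field (R\<lparr>carrier := \<R> 0\<rparr>)"
      using R0 by (simp add: finitely_generated_module_def)
    have "\<R> 0 \<subseteq> W" if W: "submodule W complex_field (restrict_scalars R (regular_module R))" "F \<subseteq> W" for W
    proof -
      have "additive_subgroup W R"
        using submodule.axioms(1)[OF W(1)]
        by (simp only: subgroup_restrict_scalars additive_subgroup_regular_module)
      then have Wg: "subgroup W (add_monoid R)" by (simp add: additive_subgroup_def)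
      have Ws: "a \<odot>\<^bsub>R\<^esub> w \<in> W" if "w \<in> W" for a w
        using submodule.smult_closed[OF W(1), of a w] that regular_scale[of w a]
          subgroup.mem_carrier[OF Wg that] by simp
      have sub0: "submodule (\<R> 0 \<inter> W) complex_field R"
      proof (intro submodule.intro submodule_axioms.intro)
        show "subgroup (\<R> 0 \<inter> W) (add_monoid R)"
          using RG.homogeneous_subgroup[of 0] Wg
          by (intro group.subgroups_Inter_pair[OF M.a_group]) (simp_all add: additive_subgroup_def)
      qed (auto intro: R_scale Ws)
      have "submodule (\<R> 0 \<inter> W) complex_field (R\<lparr>carrier := \<R> 0\<rparr>)"
        using submodule.submodule_is_module[OF sub0 module]
        by (intro module.module_incl_imp_submodule[OF M0]) auto
      with Fgen[OF this] F(2) W(2) show ?thesis by blast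
    qed
    then show ?thesis using F True unfolding finite_dim_degree_def spans_degree_def by blast
  next
    case False
    show ?thesis
    proof (rule Reg.finite_dim_step)
      show "generates_degree \<R> (regular_module R) \<R> Z n" using gen False by simp
      show "finite Z" by (rule Z)
      show "x \<in> \<R> k" if "(k, x) \<in> Z" for k x using Z(2)[OF that] by simp
      show "finite_dim_degree R (regular_module R) \<R> (n - k)" if "(k, x) \<in> Z" "k \<le> n" for k x
        using Z(2)[OF that(1)] that(2) by (intro less.IH) auto
    qed
  qed
qed

text \<open>For \<open>n \<le> p + d\<close> take \<open>i = n\<close> and second factor 1. For larger \<open>n\<close> split off one generator of degree
  \<open>k \<le> d\<close>: the remaining degree \<open>n - k\<close> is still at least \<open>p\<close>, so the induction hypothesis applies to
  the cofactor, and the generator is absorbed into its second factor.\<close>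

lemma split_off_factor:
  assumes Z: "\<And>k x. (k, x) \<in> Z \<Longrightarrow> 1 \<le> k \<and> k \<le> d \<and> x \<in> \<R> k"
    and gen: "\<And>n. 1 \<le> n \<Longrightarrow> generates_degree \<R> (regular_module R) \<R> Z n"
    and W: "additive_subgroup W R" and n: "p \<le> n"
    and prod: "\<And>i a b. p \<le> i \<Longrightarrow> i \<le> p + d \<Longrightarrow> i \<le> n \<Longrightarrow> a \<in> \<R> i \<Longrightarrow> b \<in> \<R> (n - i) \<Longrightarrow> a \<otimes>\<^bsub>R\<^esub> b \<in> W"
  shows "\<R> n \<subseteq> W"
  using W n prod
proof (induction n arbitrary: W rule: less_induct)
  case (less n)
  show ?case
  proof (cases "n \<le> p + d")
    case True
    show ?thesis
    proof
      fix r assume r: "r \<in> \<R> n"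
      then have "r \<otimes>\<^bsub>R\<^esub> \<one>\<^bsub>R\<^esub> \<in> W" using less.prems(2) True R_one by (intro less.prems(3)) auto
      then show "r \<in> W" using RG.homogeneous_closed[OF r] by simp
    qed
  next
    case False
    have "s \<otimes>\<^bsub>R\<^esub> x \<in> W" if kx: "(k, x) \<in> Z" "k \<le> n" and s: "s \<in> \<R> (n - k)" for k x s
    proof -
      have k: "1 \<le> k" "k \<le> d" and x: "x \<in> \<R> k" using Z[OF kx(1)] by auto
      have xR: "x \<in> carrier R" using x by (rule RG.homogeneous_closed)
      have "\<R> (n - k) \<subseteq> {s \<in> carrier R. s \<otimes>\<^bsub>R\<^esub> x \<in> W}"
      proof (rule less.IH)
        show "n - k < n" "p \<le> n - k" using k kx(2) False by auto
        show "additive_subgroup {s \<in> carrier R. s \<otimes>\<^bsub>R\<^esub> x \<in> W} R"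
          using Reg.preimage_smult_elem[of W x] less.prems(1) xR by (simp add: additive_subgroup_regular_module)
        fix i a b assume i: "p \<le> i" "i \<le> p + d" "i \<le> n - k" and a: "a \<in> \<R> i" and b: "b \<in> \<R> (n - k - i)"
        have ab: "a \<in> carrier R" "b \<in> carrier R" using a b RG.homogeneous_closed by auto
        have "n - k - i + k = n - i" using i kx(2) by simp
        then have "b \<otimes>\<^bsub>R\<^esub> x \<in> \<R> (n - i)" using R_mult[OF b x] by simp
        then have "a \<otimes>\<^bsub>R\<^esub> (b \<otimes>\<^bsub>R\<^esub> x) \<in> W" using i a by (intro less.prems(3)) auto
        then show "a \<otimes>\<^bsub>R\<^esub> b \<in> {s \<in> carrier R. s \<otimes>\<^bsub>R\<^esub> x \<in> W}" using ab xR by (simp add: m_assoc)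
      qed
      then show ?thesis using s by blast
    qed
    then have "contains_multiples \<R> (regular_module R) Z n W"
      using less.prems(1) unfolding contains_multiples_def by (auto simp: additive_subgroup_regular_module)
    moreover have "1 \<le> n" using False by simp
    ultimately show ?thesis using gen unfolding generates_degree_def by blast
  qed
qed

text \<open>For fixed \<open>i\<close> the scalar is an affine function of \<open>n\<close> with slope \<open>-\<kappa>\<close>, so it has at most one zero.\<close>

lemma coef_nonzero_eventually:
  assumes "\<kappa> \<noteq> 0" "finite I"
  shows "\<exists>n0. \<forall>n>n0. \<forall>i\<in>I. i \<le> n \<longrightarrow> coef i (n - i) \<noteq> 0"
proof -
  have "finite {n. i \<le> n \<and> coef i (n - i) = 0}" for i
  proof (rule finite_subset)
    let ?z = "of_nat i + (l + \<mu> * of_nat i) / \<kappa>"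
    show "{n. i \<le> n \<and> coef i (n - i) = 0} \<subseteq> of_nat -` {?z}"
      using assms(1) by (auto simp: of_nat_diff field_simps)
    show "finite (of_nat -` {?z} :: nat set)"
      by (intro finite_vimageI) (auto simp: inj_def)
  qed
  then have "finite (\<Union>i\<in>I. {n. i \<le> n \<and> coef i (n - i) = 0})" using assms(2) by blast
  then obtain n0 where "\<And>n. n \<in> (\<Union>i\<in>I. {n. i \<le> n \<and> coef i (n - i) = 0}) \<Longrightarrow> n \<le> n0"
    using finite_nat_set_iff_bounded_le by auto
  then show ?thesis by (intro exI[of _ n0]) fastforce
qed

section \<open>Finite generation over the Euler Lie algebra\<close>

theorem finitely_generated_euler_module:
  assumes R0: "finitely_generated_module complex_field (R\<lparr>carrier := \<R> 0\<rparr>)"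
    and R: "\<exists>S. finite S \<and> S \<subseteq> carrier R \<and> generate_ring R (\<R> 0 \<union> S) = carrier R"
    and \<kappa>: "\<kappa> \<noteq> 0"
    and M: "finitely_generated_module R M"
  shows "finitely_generated_lie_module complex_field (R\<lparr>carrier := degree_ge R \<R> N\<rparr>) br
    ((restrict_scalars R M)\<lparr>carrier := degree_ge M \<M> N\<rparr>) act"
proof -
  obtain Z where Z: "finite Z" "\<And>k x. (k, x) \<in> Z \<Longrightarrow> 1 \<le> k \<and> x \<in> \<R> k"
    and Zgen: "\<And>n. 1 \<le> n \<Longrightarrow> generates_degree \<R> (regular_module R) \<R> Z n"
    using finite_homogeneous_algebra_generators[OF R] by blast
  obtain Y where Y: "finite Y" "\<And>k y. (k, y) \<in> Y \<Longrightarrow> y \<in> \<M> k"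
    and Ygen: "\<And>n. generates_degree \<R> M \<M> Y n"
    using finite_homogeneous_module_generators[OF M] by blast
  have fdM: "finite_dim_degree R M \<M> n" for n
    by (rule finite_dim_step[OF Ygen Y(1)]) (fact Y(2), rule finite_dim_degree_algebra[OF R0 Z Zgen])
  obtain d where d: "\<And>k x. (k, x) \<in> Z \<Longrightarrow> k \<le> d"
    using finite_imageI[OF Z(1), of fst] unfolding finite_nat_set_iff_bounded_le by force
  obtain e where e: "\<And>k y. (k, y) \<in> Y \<Longrightarrow> k \<le> e"
    using finite_imageI[OF Y(1), of fst] unfolding finite_nat_set_iff_bounded_le by force
  \<comment> \<open>\<open>i \<ge> Suc N\<close> makes the ring factor an element of the truncated Lie algebra and also forces
  \<open>n - i < n\<close>, even for \<open>N = 0\<close>.\<close>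
  let ?p = "Suc N"
  obtain n1 where n1: "\<forall>n>n1. \<forall>i\<in>{?p..?p + d}. i \<le> n \<longrightarrow> coef i (n - i) \<noteq> 0"
    using coef_nonzero_eventually[OF \<kappa> finite_atLeastAtMost] by (rule exE)
  \<comment> \<open>Beyond \<open>n0\<close> the scalars for these \<open>i\<close> do not vanish, \<open>n - k \<ge> Suc N\<close> for every generator degree \<open>k\<close> of \<open>M\<close>, and
  \<open>n - i \<ge> N\<close>, so that the other factor lies in the truncated module.\<close>
  define n0 where "n0 = n1 + e + ?p + d + N"
  define F where "F n = (SOME F. spans_degree R M \<M> n F)" for n
  have F: "spans_degree R M \<M> n (F n)" for n
    unfolding F_def using fdM[of n] unfolding finite_dim_degree_def by (rule someI_ex)
  let ?S = "\<Union>n\<in>{N..n0}. F n"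
  let ?L = "R\<lparr>carrier := degree_ge R \<R> N\<rparr>"
  let ?V = "(restrict_scalars R M)\<lparr>carrier := degree_ge M \<M> N\<rparr>"
  have "W = degree_ge M \<M> N" if W: "lie_submodule W complex_field ?L ?V act" and S: "?S \<subseteq> W" for W
  proof
    have WV: "submodule W complex_field ?V" using W by (simp add: lie_submodule_def)
    then show "W \<subseteq> degree_ge M \<M> N"
      using subgroup.subset[OF submodule.axioms(1)[OF WV]] by simp
    have WC: "submodule W complex_field (restrict_scalars R M)"
      by (rule submodule_of_submodule[OF WV degree_ge_submodule C.module_axioms])
    have Wg: "additive_subgroup W M"
      using submodule.axioms(1)[OF WC] by (simp only: subgroup_restrict_scalars)
    have Wact: "act x w \<in> W" if "x \<in> degree_ge R \<R> N" "w \<in> W" for x w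
      using W that by (simp add: lie_submodule_def)
    have "\<M> n \<subseteq> W" if "N \<le> n" for n
      using that
    proof (induction n rule: less_induct)
      case (less n)
      show ?case
      proof (cases "n \<le> n0")
        case True
        have "F n \<subseteq> ?S" using True less.prems by (intro UN_upper) simp
        then have "F n \<subseteq> W" using S by (rule order_trans)
        then show ?thesis using F[of n] WC by (simp add: spans_degree_def)
      next
        case False
        have prod: "a \<odot>\<^bsub>M\<^esub> m \<in> W"
          if i: "?p \<le> i" "i \<le> ?p + d" and a: "a \<in> \<R> i" and m: "m \<in> \<M> (n - i)" for i a m
        proof -
          have i_n: "i \<le> n" "N \<le> n - i" "n - i < n" "n1 < n"
            using i False by (auto simp: n0_def)
          have aM: "a \<in> carrier R" "m \<in> carrier M"
            using a m RG.homogeneous_closed MG.homogeneous_closed by auto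
          have c: "coef i (n - i) \<noteq> 0" using n1[rule_format, of n i] i i_n by simp
          have "m \<in> W" using less.IH[OF i_n(3,2)] m by blast
          then have "act a m \<in> W"
            using i a by (intro Wact RG.homogeneous_degree_ge[OF a]) auto
          then have "scale (inverse (coef i (n - i))) (scale (coef i (n - i)) (a \<odot>\<^bsub>M\<^esub> m)) \<in> W"
            using submodule.smult_closed[OF WC] by (simp add: act_homogeneous[OF a m])
          then show ?thesis
            using c aM by (simp add: scale_scale scale_1 del: of_nat_diff)
        qed
        have "s \<odot>\<^bsub>M\<^esub> y \<in> W" if ky: "(k, y) \<in> Y" "k \<le> n" and s: "s \<in> \<R> (n - k)" for k y s
        proof -
          have y: "y \<in> \<M> k" "y \<in> carrier M" using Y(2)[OF ky(1)] MG.homogeneous_closed by auto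
          have "\<R> (n - k) \<subseteq> {s \<in> carrier R. s \<odot>\<^bsub>M\<^esub> y \<in> W}"
          proof (rule split_off_factor)
            show "1 \<le> j \<and> j \<le> d \<and> x \<in> \<R> j" if "(j, x) \<in> Z" for j x
              using Z(2)[OF that] d[OF that] by simp
            show "?p \<le> n - k" using e[OF ky(1)] False by (auto simp: n0_def)
            fix i a b assume i: "?p \<le> i" "i \<le> ?p + d" "i \<le> n - k" and a: "a \<in> \<R> i" and b: "b \<in> \<R> (n - k - i)"
            have ab: "a \<in> carrier R" "b \<in> carrier R" using a b RG.homogeneous_closed by auto
            have "n - k - i + k = n - i" using i ky(2) by simp
            then have "b \<odot>\<^bsub>M\<^esub> y \<in> \<M> (n - i)" using M_smult[OF b y(1)] by simp
            then have "a \<odot>\<^bsub>M\<^esub> (b \<odot>\<^bsub>M\<^esub> y) \<in> W" by (rule prod[OF i(1,2) a])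
            then show "a \<otimes>\<^bsub>R\<^esub> b \<in> {s \<in> carrier R. s \<odot>\<^bsub>M\<^esub> y \<in> W}"
              using ab y by (simp add: Mod.smult_assoc1)
          qed (use Zgen preimage_smult_elem[OF Wg y(2)] in auto)
          then show ?thesis using s by blast
        qed
        then have "contains_multiples \<R> M Y n W"
          using Wg unfolding contains_multiples_def by auto
        then show ?thesis using Ygen unfolding generates_degree_def by blast
      qed
    qed
    then show "degree_ge M \<M> N \<subseteq> W"
      using additive_subgroup.a_closed[OF Wg] by (auto elim!: MG.degree_ge_induct)
  qed
  moreover have "finite ?S" using F by (simp add: spans_degree_def)
  moreover have "?S \<subseteq> degree_ge M \<M> N"
  proof (intro UN_least)
    fix n assume n: "n \<in> {N..n0}"
    show "F n \<subseteq> degree_ge M \<M> N"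
      using F[of n] n MG.homogeneous_degree_ge[of _ n N] by (auto simp: spans_degree_def)
  qed
  ultimately show ?thesis
    unfolding finitely_generated_lie_module_def
    using lie_module_degree_ge[of N] by (intro conjI exI[of _ ?S]) auto
qed

end

theorem lemma1p6:
  fixes R :: "(complex, 'r) module" and \<R> :: "nat \<Rightarrow> 'r set"
    and M :: "('r, 'm) module" and \<M> :: "nat \<Rightarrow> 'm set"
    and \<kappa> l \<mu> :: complex and N :: nat
  assumes "graded_algebra complex_field R \<R>"
    and "finitely_generated_module complex_field (R\<lparr>carrier := \<R> 0\<rparr>)"
    and "\<exists>S. finite S \<and> S \<subseteq> carrier R \<and> generate_ring R (\<R> 0 \<union> S) = carrier R"
    and "\<kappa> \<noteq> 0"
    and "graded_module complex_field R \<R> M \<M>"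
    and "finitely_generated_module R M"
  shows "finitely_generated_lie_module complex_field
    (R\<lparr>carrier := degree_ge R \<R> N\<rparr>) (euler_bracket \<kappa> R \<R>)
    ((restrict_scalars R M)\<lparr>carrier := degree_ge M \<M> N\<rparr>) (euler_action \<kappa> l \<mu> R \<R> M \<M>)"
proof -
  interpret euler_module R \<R> M \<M> \<kappa> l \<mu>
    by (intro euler_module.intro complex_graded_module.intro assms(5))
  show ?thesis
    by (rule finitely_generated_euler_module[OF assms(2,3,4,6)])
qed

end
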